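(* Let $\mathcal{A}$ be an abelian category with small direct sums and exact small products, and assume that $\mathcal{A}$ has a $\kappa$-compact generator $G$ for some regular cardinal $\kappa$. Then for any inverse sequence $S$ in $\mathcal{A}$ there exists a universal initial morphism to a local inverse sequence $$S\longrightarrow \mathcal{L}(S),$$ i.e. $\mathcal{L}(S)$ is local and every morphism from $S$ to a local inverse sequence factors uniquely through $S\to\mathcal{L}(S)$. In other words, the full subcategory of local inverse sequences is a reflective subcategory of the category $\mathcal{A}^{\omega^{\mathrm{op}}}$ of inverse sequences in $\mathcal{A}$.
   Context: A generator of $\mathcal{A}$ is an object $G$ such that the functor $\mathcal{A}(G,-)$ is faithful. For a regular cardinal $\kappa$, a poset is $\kappa$-directed if any subset of it of cardinality $<\kappa$ has an upper bound; an object $c$ of a category $\mathcal{C}$ is $\kappa$-compact if $\mathcal{C}(c,-)$ commutes with colimits over $\kappa$-directed posets. An inverse sequence $S$ in $\mathcal{A}$ consists of objects $S_i$ and morphisms $f_i:S_{i+1}\to S_i$, $i\in\omega=\{0,1,2,\dots\}$, i.e. it is a functor $\omega^{\mathrm{op}}\to\mathcal{A}$. The objects $\lim S$ and $\lim^1 S$ (the limit and its first right derived functor) are the kernel and the cokernel of $1-F:\prod_i S_i\to\prod_i S_i$, where $\mathrm{pr}_jF=f_j\,\mathrm{pr}_{j+1}$. $S$ is called local if $\lim S=\lim^1 S=0$. *)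

theory Defs
  imports "HOL-Algebra.Group"
begin

unbundle cardinal_syntax


section \<open>Smallness\<close>

text \<open>
  Small sets are those of cardinality below a fixed strongly inaccessible cardinal \<open>\<Lambda>\<close>
  (equivalently, up to bijection, the elements of a fixed uncountable Grothendieck universe).
  Up to bijection every such set is a subset of the type \<open>'u\<close> that carries \<open>\<Lambda>\<close>, so
  quantification over small index sets is quantification over small sets of type \<open>'u set\<close>.
\<close>

definition regular_cardinal :: "'u rel \<Rightarrow> bool" where
  "regular_cardinal \<kappa> \<longleftrightarrow> Cinfinite \<kappa> \<and> regularCard \<kappa>"

definition inaccessible_cardinal :: "'u rel \<Rightarrow> bool" where
  "inaccessible_cardinal \<Lambda> \<longleftrightarrow> regular_cardinal \<Lambda> \<and> natLeq <o \<Lambda> \<and>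
     (\<forall>X :: 'u set. |X| <o \<Lambda> \<longrightarrow> |Pow X| <o \<Lambda>)"

definition small :: "'u rel \<Rightarrow> 'a set \<Rightarrow> bool" where
  "small \<Lambda> X \<longleftrightarrow> |X| <o \<Lambda>"


section \<open>Categories\<close>

record ('o, 'm) cat =
  obj :: "'o set"
  arr :: "'m set"
  src :: "'m \<Rightarrow> 'o"
  tgt :: "'m \<Rightarrow> 'o"
  ident :: "'o \<Rightarrow> 'm"
  comp :: "'m \<Rightarrow> 'm \<Rightarrow> 'm"  (infixr \<open>\<cdot>\<index>\<close> 70)

definition Hom :: "('o, 'm, 'x) cat_scheme \<Rightarrow> 'o \<Rightarrow> 'o \<Rightarrow> 'm set" where
  "Hom C X Y = {f \<in> arr C. src C f = X \<and> tgt C f = Y}"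

locale category =
  fixes C :: "('o, 'm, 'x) cat_scheme" (structure)
  assumes src_obj: "f \<in> arr C \<Longrightarrow> src C f \<in> obj C"
    and tgt_obj: "f \<in> arr C \<Longrightarrow> tgt C f \<in> obj C"
    and ident_Hom: "X \<in> obj C \<Longrightarrow> ident C X \<in> Hom C X X"
    and comp_Hom: "f \<in> Hom C X Y \<Longrightarrow> g \<in> Hom C Y Z \<Longrightarrow> g \<cdot> f \<in> Hom C X Z"
    and comp_ident: "f \<in> Hom C X Y \<Longrightarrow> f \<cdot> ident C X = f"
    and ident_comp: "f \<in> Hom C X Y \<Longrightarrow> ident C Y \<cdot> f = f"
    and comp_assoc: "f \<in> Hom C W X \<Longrightarrow> g \<in> Hom C X Y \<Longrightarrow> h \<in> Hom C Y Z \<Longrightarrow>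
      (h \<cdot> g) \<cdot> f = h \<cdot> (g \<cdot> f)"

definition locally_small :: "'u rel \<Rightarrow> ('o, 'm, 'x) cat_scheme \<Rightarrow> bool" where
  "locally_small \<Lambda> C \<longleftrightarrow> (\<forall>X\<in>obj C. \<forall>Y\<in>obj C. small \<Lambda> (Hom C X Y))"

definition is_zero_object :: "('o, 'm, 'x) cat_scheme \<Rightarrow> 'o \<Rightarrow> bool" where
  "is_zero_object C Z \<longleftrightarrow> Z \<in> obj C \<and>
     (\<forall>X\<in>obj C. (\<exists>!f. f \<in> Hom C Z X) \<and> (\<exists>!f. f \<in> Hom C X Z))"

definition is_mono :: "('o, 'm, 'x) cat_scheme \<Rightarrow> 'm \<Rightarrow> bool" where
  "is_mono C f \<longleftrightarrow> f \<in> arr C \<and>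
     (\<forall>W\<in>obj C. \<forall>g\<in>Hom C W (src C f). \<forall>h\<in>Hom C W (src C f).
        f \<cdot>\<^bsub>C\<^esub> g = f \<cdot>\<^bsub>C\<^esub> h \<longrightarrow> g = h)"

definition is_epi :: "('o, 'm, 'x) cat_scheme \<Rightarrow> 'm \<Rightarrow> bool" where
  "is_epi C f \<longleftrightarrow> f \<in> arr C \<and>
     (\<forall>W\<in>obj C. \<forall>g\<in>Hom C (tgt C f) W. \<forall>h\<in>Hom C (tgt C f) W.
        g \<cdot>\<^bsub>C\<^esub> f = h \<cdot>\<^bsub>C\<^esub> f \<longrightarrow> g = h)"

definition is_product ::
  "('o, 'm, 'x) cat_scheme \<Rightarrow> 'i set \<Rightarrow> ('i \<Rightarrow> 'o) \<Rightarrow> 'o \<Rightarrow> ('i \<Rightarrow> 'm) \<Rightarrow> bool" where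
  "is_product C I X P p \<longleftrightarrow> P \<in> obj C \<and> (\<forall>i\<in>I. p i \<in> Hom C P (X i)) \<and>
     (\<forall>W\<in>obj C. \<forall>q. (\<forall>i\<in>I. q i \<in> Hom C W (X i)) \<longrightarrow>
        (\<exists>!u. u \<in> Hom C W P \<and> (\<forall>i\<in>I. p i \<cdot>\<^bsub>C\<^esub> u = q i)))"

definition is_coproduct ::
  "('o, 'm, 'x) cat_scheme \<Rightarrow> 'i set \<Rightarrow> ('i \<Rightarrow> 'o) \<Rightarrow> 'o \<Rightarrow> ('i \<Rightarrow> 'm) \<Rightarrow> bool" where
  "is_coproduct C I X P \<iota> \<longleftrightarrow> P \<in> obj C \<and> (\<forall>i\<in>I. \<iota> i \<in> Hom C (X i) P) \<and>
     (\<forall>W\<in>obj C. \<forall>q. (\<forall>i\<in>I. q i \<in> Hom C (X i) W) \<longrightarrow>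
        (\<exists>!u. u \<in> Hom C P W \<and> (\<forall>i\<in>I. u \<cdot>\<^bsub>C\<^esub> \<iota> i = q i)))"

definition has_small_products :: "'u rel \<Rightarrow> ('o, 'm, 'x) cat_scheme \<Rightarrow> bool" where
  "has_small_products \<Lambda> C \<longleftrightarrow> (\<forall>(I :: 'u set) X. small \<Lambda> I \<longrightarrow> (\<forall>i\<in>I. X i \<in> obj C) \<longrightarrow>
     (\<exists>P p. is_product C I X P p))"

definition has_small_coproducts :: "'u rel \<Rightarrow> ('o, 'm, 'x) cat_scheme \<Rightarrow> bool" where
  "has_small_coproducts \<Lambda> C \<longleftrightarrow> (\<forall>(I :: 'u set) X. small \<Lambda> I \<longrightarrow> (\<forall>i\<in>I. X i \<in> obj C) \<longrightarrow>
     (\<exists>P \<iota>. is_coproduct C I X P \<iota>))"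

definition is_generator :: "('o, 'm, 'x) cat_scheme \<Rightarrow> 'o \<Rightarrow> bool" where
  "is_generator C G \<longleftrightarrow> G \<in> obj C \<and>
     (\<forall>X\<in>obj C. \<forall>Y\<in>obj C. \<forall>f\<in>Hom C X Y. \<forall>g\<in>Hom C X Y.
        (\<forall>h\<in>Hom C G X. f \<cdot>\<^bsub>C\<^esub> h = g \<cdot>\<^bsub>C\<^esub> h) \<longrightarrow> f = g)"


section \<open>Compact objects\<close>

definition directed_poset :: "'u rel \<Rightarrow> 'i set \<Rightarrow> 'i rel \<Rightarrow> bool" where
  "directed_poset \<kappa> D r \<longleftrightarrow> partial_order_on D r \<and>
     (\<forall>B. B \<subseteq> D \<longrightarrow> |B| <o \<kappa> \<longrightarrow> (\<exists>u\<in>D. \<forall>b\<in>B. (b, u) \<in> r))"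

definition is_diagram ::
  "('o, 'm, 'x) cat_scheme \<Rightarrow> 'i set \<Rightarrow> 'i rel \<Rightarrow> ('i \<Rightarrow> 'o) \<Rightarrow> ('i \<Rightarrow> 'i \<Rightarrow> 'm) \<Rightarrow> bool" where
  "is_diagram C D r X t \<longleftrightarrow> (\<forall>i\<in>D. X i \<in> obj C) \<and>
     (\<forall>i j. (i, j) \<in> r \<longrightarrow> t i j \<in> Hom C (X i) (X j)) \<and>
     (\<forall>i\<in>D. t i i = ident C (X i)) \<and>
     (\<forall>i j k. (i, j) \<in> r \<longrightarrow> (j, k) \<in> r \<longrightarrow> t j k \<cdot>\<^bsub>C\<^esub> t i j = t i k)"

definition is_cocone ::
  "('o, 'm, 'x) cat_scheme \<Rightarrow> 'i set \<Rightarrow> 'i rel \<Rightarrow> ('i \<Rightarrow> 'o) \<Rightarrow> ('i \<Rightarrow> 'i \<Rightarrow> 'm) \<Rightarrow>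
    'o \<Rightarrow> ('i \<Rightarrow> 'm) \<Rightarrow> bool" where
  "is_cocone C D r X t L \<iota> \<longleftrightarrow> L \<in> obj C \<and> (\<forall>i\<in>D. \<iota> i \<in> Hom C (X i) L) \<and>
     (\<forall>i j. (i, j) \<in> r \<longrightarrow> \<iota> j \<cdot>\<^bsub>C\<^esub> t i j = \<iota> i)"

definition is_colimit ::
  "('o, 'm, 'x) cat_scheme \<Rightarrow> 'i set \<Rightarrow> 'i rel \<Rightarrow> ('i \<Rightarrow> 'o) \<Rightarrow> ('i \<Rightarrow> 'i \<Rightarrow> 'm) \<Rightarrow>
    'o \<Rightarrow> ('i \<Rightarrow> 'm) \<Rightarrow> bool" where
  "is_colimit C D r X t L \<iota> \<longleftrightarrow> is_cocone C D r X t L \<iota> \<and>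
     (\<forall>W q. is_cocone C D r X t W q \<longrightarrow>
        (\<exists>!u. u \<in> Hom C L W \<and> (\<forall>i\<in>D. u \<cdot>\<^bsub>C\<^esub> \<iota> i = q i)))"

text \<open>
  The colimit of the sets \<open>Hom C c (X i)\<close>, constructed as the quotient of their disjoint union
  by the equivalence relation generated by \<open>(i, a) \<sim> (j, t i j \<cdot> a)\<close>.
\<close>

definition hom_step ::
  "('o, 'm, 'x) cat_scheme \<Rightarrow> 'o \<Rightarrow> 'i rel \<Rightarrow> ('i \<Rightarrow> 'o) \<Rightarrow> ('i \<Rightarrow> 'i \<Rightarrow> 'm) \<Rightarrow> ('i \<times> 'm) rel" where
  "hom_step C c r X t =
     {((i, a), (j, b)). (i, j) \<in> r \<and> a \<in> Hom C c (X i) \<and> b = t i j \<cdot>\<^bsub>C\<^esub> a}"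

definition hom_colimit ::
  "('o, 'm, 'x) cat_scheme \<Rightarrow> 'o \<Rightarrow> 'i set \<Rightarrow> 'i rel \<Rightarrow> ('i \<Rightarrow> 'o) \<Rightarrow> ('i \<Rightarrow> 'i \<Rightarrow> 'm) \<Rightarrow>
    ('i \<times> 'm) set set" where
  "hom_colimit C c D r X t =
     (SIGMA i:D. Hom C c (X i)) // ((hom_step C c r X t \<union> (hom_step C c r X t)\<inverse>)\<^sup>*)"

text \<open>
  The canonical map from that colimit to \<open>Hom C c L\<close>, for a cocone \<open>(L, \<iota>)\<close>. The image below is
  a singleton for every class \<open>K\<close>, because \<open>(i, a) \<mapsto> \<iota> i \<cdot> a\<close> respects the relation.
\<close>

definition hom_comparison ::
  "('o, 'm, 'x) cat_scheme \<Rightarrow> ('i \<Rightarrow> 'm) \<Rightarrow> ('i \<times> 'm) set \<Rightarrow> 'm" where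
  "hom_comparison C \<iota> K = the_elem ((\<lambda>(i, a). \<iota> i \<cdot>\<^bsub>C\<^esub> a) ` K)"

definition is_compact :: "'u rel \<Rightarrow> 'u rel \<Rightarrow> ('o, 'm, 'x) cat_scheme \<Rightarrow> 'o \<Rightarrow> bool" where
  "is_compact \<Lambda> \<kappa> C c \<longleftrightarrow> c \<in> obj C \<and>
     (\<forall>(D :: 'u set) r X t L \<iota>. small \<Lambda> D \<longrightarrow> directed_poset \<kappa> D r \<longrightarrow> is_diagram C D r X t \<longrightarrow>
        is_colimit C D r X t L \<iota> \<longrightarrow>
        bij_betw (hom_comparison C \<iota>) (hom_colimit C c D r X t) (Hom C c L))"


section \<open>Abelian categories\<close>

record ('o, 'm) preadd_cat = "('o, 'm) cat" +
  hadd :: "'m \<Rightarrow> 'm \<Rightarrow> 'm"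
  hzero :: "'o \<Rightarrow> 'o \<Rightarrow> 'm"

definition hom_group :: "('o, 'm, 'x) preadd_cat_scheme \<Rightarrow> 'o \<Rightarrow> 'o \<Rightarrow> 'm monoid" where
  "hom_group A X Y = \<lparr>carrier = Hom A X Y, mult = hadd A, one = hzero A X Y\<rparr>"

definition hdiff :: "('o, 'm, 'x) preadd_cat_scheme \<Rightarrow> 'm \<Rightarrow> 'm \<Rightarrow> 'm" where
  "hdiff A f g = hadd A f (inv\<^bsub>hom_group A (src A g) (tgt A g)\<^esub> g)"

definition is_kernel :: "('o, 'm, 'x) preadd_cat_scheme \<Rightarrow> 'm \<Rightarrow> 'm \<Rightarrow> bool" where
  "is_kernel A f k \<longleftrightarrow> f \<in> arr A \<and> k \<in> arr A \<and> tgt A k = src A f \<and>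
     f \<cdot>\<^bsub>A\<^esub> k = hzero A (src A k) (tgt A f) \<and>
     (\<forall>W\<in>obj A. \<forall>h\<in>Hom A W (src A f). f \<cdot>\<^bsub>A\<^esub> h = hzero A W (tgt A f) \<longrightarrow>
        (\<exists>!u. u \<in> Hom A W (src A k) \<and> k \<cdot>\<^bsub>A\<^esub> u = h))"

definition is_cokernel :: "('o, 'm, 'x) preadd_cat_scheme \<Rightarrow> 'm \<Rightarrow> 'm \<Rightarrow> bool" where
  "is_cokernel A f c \<longleftrightarrow> f \<in> arr A \<and> c \<in> arr A \<and> src A c = tgt A f \<and>
     c \<cdot>\<^bsub>A\<^esub> f = hzero A (src A f) (tgt A c) \<and>
     (\<forall>W\<in>obj A. \<forall>h\<in>Hom A (tgt A f) W. h \<cdot>\<^bsub>A\<^esub> f = hzero A (src A f) W \<longrightarrow>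
        (\<exists>!u. u \<in> Hom A (tgt A c) W \<and> u \<cdot>\<^bsub>A\<^esub> c = h))"

locale preadditive_category = category A
  for A :: "('o, 'm, 'x) preadd_cat_scheme" (structure) +
  assumes hom_comm_group: "X \<in> obj A \<Longrightarrow> Y \<in> obj A \<Longrightarrow> comm_group (hom_group A X Y)"
    and comp_hadd_left: "f \<in> Hom A X Y \<Longrightarrow> g \<in> Hom A Y Z \<Longrightarrow> h \<in> Hom A Y Z \<Longrightarrow>
      hadd A g h \<cdot> f = hadd A (g \<cdot> f) (h \<cdot> f)"
    and comp_hadd_right: "f \<in> Hom A X Y \<Longrightarrow> g \<in> Hom A X Y \<Longrightarrow> h \<in> Hom A Y Z \<Longrightarrow>
      h \<cdot> hadd A f g = hadd A (h \<cdot> f) (h \<cdot> g)"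

text \<open>In a preadditive category binary products are automatically biproducts.\<close>

locale abelian_category = preadditive_category +
  assumes zero_object: "\<exists>Z. is_zero_object A Z"
    and binary_products: "X \<in> obj A \<Longrightarrow> Y \<in> obj A \<Longrightarrow>
      \<exists>P p. is_product A UNIV (\<lambda>b :: bool. if b then X else Y) P p"
    and kernels: "f \<in> arr A \<Longrightarrow> \<exists>k. is_kernel A f k"
    and cokernels: "f \<in> arr A \<Longrightarrow> \<exists>c. is_cokernel A f c"
    and monos_normal: "is_mono A f \<Longrightarrow> \<exists>g. is_kernel A g f"
    and epis_normal: "is_epi A f \<Longrightarrow> \<exists>g. is_cokernel A g f"

definition short_exact :: "('o, 'm, 'x) preadd_cat_scheme \<Rightarrow> 'm \<Rightarrow> 'm \<Rightarrow> bool" where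
  "short_exact A f g \<longleftrightarrow> is_kernel A g f \<and> is_cokernel A f g"

text \<open>
  The product functors over small index sets exist and are exact: a product of short exact
  sequences \<open>X i \<rightarrow> Y i \<rightarrow> Z i\<close> is short exact.
\<close>

definition has_exact_small_products :: "'u rel \<Rightarrow> ('o, 'm, 'x) preadd_cat_scheme \<Rightarrow> bool" where
  "has_exact_small_products \<Lambda> A \<longleftrightarrow> has_small_products \<Lambda> A \<and>
     (\<forall>(I :: 'u set) X Y Z f g P p Q q R s F G.
        small \<Lambda> I \<longrightarrow>
        (\<forall>i\<in>I. f i \<in> Hom A (X i) (Y i) \<and> g i \<in> Hom A (Y i) (Z i) \<and> short_exact A (f i) (g i)) \<longrightarrow>
        is_product A I X P p \<longrightarrow> is_product A I Y Q q \<longrightarrow> is_product A I Z R s \<longrightarrow>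
        F \<in> Hom A P Q \<longrightarrow> (\<forall>i\<in>I. q i \<cdot>\<^bsub>A\<^esub> F = f i \<cdot>\<^bsub>A\<^esub> p i) \<longrightarrow>
        G \<in> Hom A Q R \<longrightarrow> (\<forall>i\<in>I. s i \<cdot>\<^bsub>A\<^esub> G = g i \<cdot>\<^bsub>A\<^esub> q i) \<longrightarrow>
        short_exact A F G)"


section \<open>Inverse sequences\<close>

text \<open>An inverse sequence is a pair \<open>(S, f)\<close> with \<open>f i : S (i + 1) \<rightarrow> S i\<close>.\<close>

type_synonym ('o, 'm) invseq = "(nat \<Rightarrow> 'o) \<times> (nat \<Rightarrow> 'm)"

definition is_invseq :: "('o, 'm, 'x) cat_scheme \<Rightarrow> ('o, 'm) invseq \<Rightarrow> bool" where
  "is_invseq C S \<longleftrightarrow> (\<forall>i. fst S i \<in> obj C \<and> snd S i \<in> Hom C (fst S (Suc i)) (fst S i))"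

text \<open>Morphisms carry their source and target: \<open>(S, T, \<phi>)\<close> stands for \<open>\<phi> : S \<rightarrow> T\<close>.\<close>

definition invseq_cat :: "('o, 'm, 'x) cat_scheme \<Rightarrow>
    (('o, 'm) invseq, ('o, 'm) invseq \<times> ('o, 'm) invseq \<times> (nat \<Rightarrow> 'm)) cat" where
  "invseq_cat C =
    \<lparr>obj = {S. is_invseq C S},
     arr = {(S, T, \<phi>). is_invseq C S \<and> is_invseq C T \<and>
              (\<forall>i. \<phi> i \<in> Hom C (fst S i) (fst T i)) \<and>
              (\<forall>i. snd T i \<cdot>\<^bsub>C\<^esub> \<phi> (Suc i) = \<phi> i \<cdot>\<^bsub>C\<^esub> snd S i)},
     src = (\<lambda>(S, T, \<phi>). S),
     tgt = (\<lambda>(S, T, \<phi>). T),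
     ident = (\<lambda>S. (S, S, \<lambda>i. ident C (fst S i))),
     comp = (\<lambda>(T, U, \<psi>) (S, T', \<phi>). (S, U, \<lambda>i. \<psi> i \<cdot>\<^bsub>C\<^esub> \<phi> i))\<rparr>"

definition is_shift :: "('o, 'm, 'x) cat_scheme \<Rightarrow> ('o, 'm) invseq \<Rightarrow>
    'o \<Rightarrow> (nat \<Rightarrow> 'm) \<Rightarrow> 'm \<Rightarrow> bool" where
  "is_shift C S P pr F \<longleftrightarrow> is_product C UNIV (fst S) P pr \<and> F \<in> Hom C P P \<and>
     (\<forall>j. pr j \<cdot>\<^bsub>C\<^esub> F = snd S j \<cdot>\<^bsub>C\<^esub> pr (Suc j))"

definition is_lim :: "('o, 'm, 'x) preadd_cat_scheme \<Rightarrow> ('o, 'm) invseq \<Rightarrow> 'o \<Rightarrow> bool" where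
  "is_lim A S L \<longleftrightarrow> (\<exists>P pr F k. is_shift A S P pr F \<and>
     is_kernel A (hdiff A (ident A P) F) k \<and> src A k = L)"

definition is_lim1 :: "('o, 'm, 'x) preadd_cat_scheme \<Rightarrow> ('o, 'm) invseq \<Rightarrow> 'o \<Rightarrow> bool" where
  "is_lim1 A S L \<longleftrightarrow> (\<exists>P pr F c. is_shift A S P pr F \<and>
     is_cokernel A (hdiff A (ident A P) F) c \<and> tgt A c = L)"

definition is_local :: "('o, 'm, 'x) preadd_cat_scheme \<Rightarrow> ('o, 'm) invseq \<Rightarrow> bool" where
  "is_local A S \<longleftrightarrow> is_invseq A S \<and>
     (\<exists>Z. is_zero_object A Z \<and> is_lim A S Z) \<and> (\<exists>Z. is_zero_object A Z \<and> is_lim1 A S Z)"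


section \<open>Reflective subcategories\<close>

definition is_functor :: "('o, 'm, 'x) cat_scheme \<Rightarrow> ('p, 'n, 'y) cat_scheme \<Rightarrow>
    ('o \<Rightarrow> 'p) \<Rightarrow> ('m \<Rightarrow> 'n) \<Rightarrow> bool" where
  "is_functor C D Fo Fa \<longleftrightarrow> (\<forall>X\<in>obj C. Fo X \<in> obj D) \<and>
     (\<forall>X\<in>obj C. \<forall>Y\<in>obj C. \<forall>f\<in>Hom C X Y. Fa f \<in> Hom D (Fo X) (Fo Y)) \<and>
     (\<forall>X\<in>obj C. Fa (ident C X) = ident D (Fo X)) \<and>
     (\<forall>X\<in>obj C. \<forall>Y\<in>obj C. \<forall>Z\<in>obj C. \<forall>f\<in>Hom C X Y. \<forall>g\<in>Hom C Y Z.
        Fa (g \<cdot>\<^bsub>C\<^esub> f) = Fa g \<cdot>\<^bsub>D\<^esub> Fa f)"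

text \<open>\<open>L : C \<rightarrow> D\<close> is left adjoint to \<open>R : D \<rightarrow> C\<close>.\<close>

definition is_adjunction :: "('o, 'm, 'x) cat_scheme \<Rightarrow> ('p, 'n, 'y) cat_scheme \<Rightarrow>
    ('o \<Rightarrow> 'p) \<Rightarrow> ('m \<Rightarrow> 'n) \<Rightarrow> ('p \<Rightarrow> 'o) \<Rightarrow> ('n \<Rightarrow> 'm) \<Rightarrow> bool" where
  "is_adjunction C D Lo La Ro Ra \<longleftrightarrow> is_functor C D Lo La \<and> is_functor D C Ro Ra \<and>
     (\<exists>\<Phi>. (\<forall>X\<in>obj C. \<forall>Y\<in>obj D. bij_betw (\<Phi> X Y) (Hom D (Lo X) Y) (Hom C X (Ro Y))) \<and>
       (\<forall>X\<in>obj C. \<forall>X'\<in>obj C. \<forall>Y\<in>obj D. \<forall>Y'\<in>obj D.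
          \<forall>u\<in>Hom C X' X. \<forall>v\<in>Hom D Y Y'. \<forall>h\<in>Hom D (Lo X) Y.
            \<Phi> X' Y' (v \<cdot>\<^bsub>D\<^esub> h \<cdot>\<^bsub>D\<^esub> La u) = Ra v \<cdot>\<^bsub>C\<^esub> \<Phi> X Y h \<cdot>\<^bsub>C\<^esub> u))"

definition full_subcategory ::
  "('o, 'm, 'x) cat_scheme \<Rightarrow> ('o \<Rightarrow> bool) \<Rightarrow> ('o, 'm, 'x) cat_scheme" where
  "full_subcategory C P =
     C\<lparr>obj := {X \<in> obj C. P X}, arr := {f \<in> arr C. P (src C f) \<and> P (tgt C f)}\<rparr>"

definition reflective :: "('o, 'm, 'x) cat_scheme \<Rightarrow> ('o \<Rightarrow> bool) \<Rightarrow> bool" where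
  "reflective C P \<longleftrightarrow>
     (\<exists>Lo La. is_adjunction C (full_subcategory C P) Lo La (\<lambda>X. X) (\<lambda>f. f))"

end

theory Submission
  imports Defs
begin

text \<open>
  In derived terms the localization of \<open>S\<close> is the cone of \<open>const (R lim S) \<rightarrow> S\<close>: since \<open>lim\<^sup>1\<close>
  vanishes on constant sequences, \<open>R lim\<close> kills this cone, and hence also its cohomology. The
  zeroth cohomology is the reflection. Explicitly, with \<open>P = \<Prod>\<^sub>i S i\<close> and \<open>F\<close> the shift of \<open>P\<close>, it is
  \<open>L j = coker ((1 - F, pr j) : P \<rightarrow> P \<oplus> S j)\<close> with transition maps induced by
  \<open>(y, s) \<mapsto> (y, f j s + pr j y)\<close>. Locality of \<open>T\<close> means that the equations
  \<open>x j = a j + f j (x (j + 1))\<close> have a unique solution for all families \<open>a j : W \<rightarrow> T j\<close>; the universal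
  property is then formal, and exactness of countable products yields the locality of \<open>L\<close>.
\<close>

section \<open>Products in categories\<close>

text \<open>The term \<open>pr j y\<close> in the transition maps comes from a homotopy. R lim S is
  represented by the complex 1 - F : P -> P. The projections \<open>pr j\<close> from its first term
  do not form a morphism from the constant sequence to S, because f j pr (j+1) = pr j - pr j (1 -
  F). The defect factors through the second term of the complex, so the projections are compatible
  only up to homotopy. Building this homotopy into the transition maps makes the sums N j = P + S j
  an extension of the constant sequence P by S, rather than a direct sum, and it makes (1 - F, pr j)
  an honest morphism d from the constant sequence P to N. The obstacle to locality of L = coker d is
  that a generalized element W -> L j need not lift to N j. The equations over L are therefore not
  solved for each W separately. They are solved once over W = product of all N j, and that solution
  is pushed down to the product of all L j. The descent requires the product of the cokernels of the
  d j to be the cokernel of the product of the d j.\<close>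

lemma is_productD:
  assumes "is_product C I X P p"
  shows "P \<in> obj C" "i \<in> I \<Longrightarrow> p i \<in> Hom C P (X i)"
  using assms by (auto simp: is_product_def)

lemma is_product_lift:
  assumes "is_product C I X P p" "W \<in> obj C" "\<And>i. i \<in> I \<Longrightarrow> q i \<in> Hom C W (X i)"
  obtains u where "u \<in> Hom C W P" "\<And>i. i \<in> I \<Longrightarrow> p i \<cdot>\<^bsub>C\<^esub> u = q i"
proof -
  have "\<exists>!u. u \<in> Hom C W P \<and> (\<forall>i\<in>I. p i \<cdot>\<^bsub>C\<^esub> u = q i)"
    using assms(1-3) by (simp add: is_product_def)
  then obtain u where "u \<in> Hom C W P \<and> (\<forall>i\<in>I. p i \<cdot>\<^bsub>C\<^esub> u = q i)" by (rule ex1E)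
  then show ?thesis by (intro that[of u]) auto
qed

context category
begin

lemma Hom_obj: "f \<in> Hom C X Y \<Longrightarrow> X \<in> obj C" "f \<in> Hom C X Y \<Longrightarrow> Y \<in> obj C"
  by (auto simp: Hom_def src_obj tgt_obj)

lemma comp_simps [simp]:
  assumes "f \<in> arr C" "g \<in> arr C" "src C g = tgt C f"
  shows "g \<cdot> f \<in> arr C" "src C (g \<cdot> f) = src C f" "tgt C (g \<cdot> f) = tgt C g"
  using comp_Hom[of f "src C f" "tgt C f" g "tgt C g"] assms by (auto simp: Hom_def)

lemma ident_simps [simp]:
  assumes "X \<in> obj C"
  shows "ident C X \<in> arr C" "src C (ident C X) = X" "tgt C (ident C X) = X"
  using ident_Hom[OF assms] by (auto simp: Hom_def)

lemma ident_comp_arr [simp]: "f \<in> arr C \<Longrightarrow> tgt C f = Y \<Longrightarrow> ident C Y \<cdot> f = f"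
  using ident_comp[of f "src C f" Y] by (auto simp: Hom_def)

lemma comp_ident_arr [simp]: "f \<in> arr C \<Longrightarrow> src C f = X \<Longrightarrow> f \<cdot> ident C X = f"
  using comp_ident[of f X "tgt C f"] by (auto simp: Hom_def)

lemma comp_assoc_arr:
  assumes "f \<in> arr C" "g \<in> arr C" "h \<in> arr C" "src C g = tgt C f" "src C h = tgt C g"
  shows "(h \<cdot> g) \<cdot> f = h \<cdot> (g \<cdot> f)"
  by (rule comp_assoc[of f "src C f" "tgt C f" g "tgt C g" h "tgt C h"])
    (use assms in \<open>auto simp: Hom_def\<close>)

lemma is_product_eqI:
  assumes P: "is_product C I X P p" and gh: "g \<in> Hom C W P" "h \<in> Hom C W P"
    and eq: "\<And>i. i \<in> I \<Longrightarrow> p i \<cdot> g = p i \<cdot> h"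
  shows "g = h"
proof -
  have "\<forall>i\<in>I. p i \<cdot> h \<in> Hom C W (X i)"
    using comp_Hom[OF gh(2) is_productD(2)[OF P]] by blast
  then have "\<exists>!u. u \<in> Hom C W P \<and> (\<forall>i\<in>I. p i \<cdot> u = p i \<cdot> h)"
    using P Hom_obj(1)[OF gh(1)] by (simp add: is_product_def)
  moreover have "g \<in> Hom C W P \<and> (\<forall>i\<in>I. p i \<cdot> g = p i \<cdot> h)" using gh(1) eq by simp
  moreover have "h \<in> Hom C W P \<and> (\<forall>i\<in>I. p i \<cdot> h = p i \<cdot> h)" using gh(2) by simp
  ultimately show ?thesis using the1_equality by fast
qed

text \<open>Small products are postulated over subsets of \<open>'u\<close>, whereas inverse
  sequences are indexed by \<open>nat\<close>; this lemma passes between the two. A cone over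
  \<open>J\<close> is carried to a cone over \<open>I\<close> along
  \<open>the_inv_into J e\<close>.\<close>

lemma is_product_reindex:
  assumes bij: "bij_betw e J I" and P: "is_product C I X P p"
  shows "is_product C J (\<lambda>j. X (e j)) P (\<lambda>j. p (e j))"
  unfolding is_product_def
proof (intro conjI ballI allI impI)
  show "P \<in> obj C" using is_productD(1)[OF P] .
  have eI: "e j \<in> I" if "j \<in> J" for j using bij that by (auto simp: bij_betw_def)
  show "p (e j) \<in> Hom C P (X (e j))" if "j \<in> J" for j using is_productD(2)[OF P eI[OF that]] .
  fix W q assume W: "W \<in> obj C" and q: "\<forall>i\<in>J. q i \<in> Hom C W (X (e i))"
  let ?inv = "the_inv_into J e"
  have inv: "?inv i \<in> J" "e (?inv i) = i" if "i \<in> I" for i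
    using bij that the_inv_into_into[of e J i J] f_the_inv_into_f[of e J i]
    by (auto simp: bij_betw_def)
  have inv': "?inv (e j) = j" if "j \<in> J" for j
    using bij that by (simp add: bij_betw_def the_inv_into_f_f)
  obtain u where u: "u \<in> Hom C W P" "\<And>i. i \<in> I \<Longrightarrow> p i \<cdot> u = q (?inv i)"
    using is_product_lift[OF P W, of "\<lambda>i. q (?inv i)"] q inv by (metis (no_types, lifting))
  show "\<exists>!u. u \<in> Hom C W P \<and> (\<forall>i\<in>J. p (e i) \<cdot> u = q i)"
  proof (rule ex1I[of _ u])
    show "u \<in> Hom C W P \<and> (\<forall>i\<in>J. p (e i) \<cdot> u = q i)" using u eI inv' by auto
    fix v assume v: "v \<in> Hom C W P \<and> (\<forall>i\<in>J. p (e i) \<cdot> v = q i)"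
    show "v = u"
    proof (rule is_product_eqI[OF P _ u(1)])
      show "p i \<cdot> v = p i \<cdot> u" if "i \<in> I" for i using v u(2)[OF that] inv[OF that] by metis
    qed (use v in simp)
  qed
qed

end

text \<open>The clause \<open>natLeq <o \<Lambda>\<close> says that \<Lambda> is uncountable, so
  \<open>nat\<close> embeds into \<open>Field \<Lambda>\<close> and its image is small. This copy of
  \<open>nat\<close> inside \<open>'u\<close> is the index set for countable products.\<close>

lemma inaccessible_countable:
  assumes "inaccessible_cardinal (\<Lambda> :: 'u rel)"
  obtains e :: "nat \<Rightarrow> 'u" where "inj e" "small \<Lambda> (range e)"
proof -
  have L: "natLeq <o \<Lambda>" "Card_order \<Lambda>"
    using assms unfolding inaccessible_cardinal_def regular_cardinal_def cinfinite_def by auto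
  have natL: "|UNIV :: nat set| <o \<Lambda>"
    by (rule ordIso_ordLess_trans[OF card_of_nat L(1)])
  have "|UNIV :: nat set| \<le>o |Field \<Lambda>|"
    by (rule ordLeq_ordIso_trans[OF ordLess_imp_ordLeq[OF natL]
          ordIso_symmetric[OF card_of_Field_ordIso[OF L(2)]]])
  then obtain e :: "nat \<Rightarrow> 'u" where e: "inj e"
    using card_of_ordLeq[of "UNIV :: nat set" "Field \<Lambda>"] by auto
  have "|range e| \<le>o |UNIV :: nat set|" by (rule card_of_image)
  then have "small \<Lambda> (range e)" unfolding small_def by (rule ordLeq_ordLess_trans[OF _ natL])
  with e show ?thesis by (rule that)
qed

section \<open>Preadditive categories\<close>

context preadditive_category
begin

abbreviation add :: "'m \<Rightarrow> 'm \<Rightarrow> 'm" (infixl \<open>\<oplus>\<close> 65)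
  where "f \<oplus> g \<equiv> hadd A f g"

text \<open>An arrow knows its source and target, so the hom-group in which it is inverted can be
  read off from it. This matches the group chosen in \<open>hdiff\<close>.\<close>

definition neg :: "'m \<Rightarrow> 'm"
  where "neg f = inv\<^bsub>hom_group A (src A f) (tgt A f)\<^esub> f"

lemma hdiff_neg: "hdiff A f g = f \<oplus> neg g"
  by (simp add: hdiff_def neg_def)

lemma add_simps [simp]:
  assumes "f \<in> arr A" "g \<in> arr A" "src A g = src A f" "tgt A g = tgt A f"
  shows "f \<oplus> g \<in> arr A" "src A (f \<oplus> g) = src A f" "tgt A (f \<oplus> g) = tgt A f"
proof -
  interpret H: comm_group "hom_group A (src A f) (tgt A f)"
    by (rule hom_comm_group) (use assms in \<open>auto simp: src_obj tgt_obj\<close>)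
  have "f \<oplus> g \<in> Hom A (src A f) (tgt A f)"
    using H.m_closed[of f g] assms by (simp add: hom_group_def Hom_def)
  then show "f \<oplus> g \<in> arr A" "src A (f \<oplus> g) = src A f" "tgt A (f \<oplus> g) = tgt A f"
    by (auto simp: Hom_def)
qed

lemma zero_simps [simp]:
  assumes "X \<in> obj A" "Y \<in> obj A"
  shows "hzero A X Y \<in> arr A" "src A (hzero A X Y) = X" "tgt A (hzero A X Y) = Y"
proof -
  interpret H: comm_group "hom_group A X Y" by (rule hom_comm_group) (use assms in auto)
  have "hzero A X Y \<in> Hom A X Y" using H.one_closed by (simp add: hom_group_def)
  then show "hzero A X Y \<in> arr A" "src A (hzero A X Y) = X" "tgt A (hzero A X Y) = Y"
    by (auto simp: Hom_def)
qed

lemma neg_simps [simp]: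
  assumes "f \<in> arr A"
  shows "neg f \<in> arr A" "src A (neg f) = src A f" "tgt A (neg f) = tgt A f"
proof -
  interpret H: comm_group "hom_group A (src A f) (tgt A f)"
    by (rule hom_comm_group) (use assms in \<open>auto simp: src_obj tgt_obj\<close>)
  have "neg f \<in> Hom A (src A f) (tgt A f)"
    using H.inv_closed[of f] assms by (simp add: hom_group_def Hom_def neg_def)
  then show "neg f \<in> arr A" "src A (neg f) = src A f" "tgt A (neg f) = tgt A f"
    by (auto simp: Hom_def)
qed

lemma add_assoc:
  assumes "f \<in> arr A" "g \<in> arr A" "h \<in> arr A" "src A g = src A f" "tgt A g = tgt A f"
    "src A h = src A f" "tgt A h = tgt A f"
  shows "(f \<oplus> g) \<oplus> h = f \<oplus> (g \<oplus> h)"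
proof -
  interpret H: comm_group "hom_group A (src A f) (tgt A f)"
    by (rule hom_comm_group) (use assms in \<open>auto simp: src_obj tgt_obj\<close>)
  show ?thesis using H.m_assoc[of f g h] assms by (simp add: hom_group_def Hom_def)
qed

lemma add_commute:
  assumes "f \<in> arr A" "g \<in> arr A" "src A g = src A f" "tgt A g = tgt A f"
  shows "f \<oplus> g = g \<oplus> f"
proof -
  interpret H: comm_group "hom_group A (src A f) (tgt A f)"
    by (rule hom_comm_group) (use assms in \<open>auto simp: src_obj tgt_obj\<close>)
  show ?thesis using H.m_comm[of f g] assms by (simp add: hom_group_def Hom_def)
qed

lemma add_left_commute:
  assumes "f \<in> arr A" "g \<in> arr A" "h \<in> arr A" "src A g = src A f" "tgt A g = tgt A f"
    "src A h = src A f" "tgt A h = tgt A f"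
  shows "f \<oplus> (g \<oplus> h) = g \<oplus> (f \<oplus> h)"
  using assms add_assoc[of f g h] add_assoc[of g f h] add_commute[of f g] by simp

lemma zero_add [simp]:
  assumes "f \<in> arr A" "src A f = X" "tgt A f = Y"
  shows "hzero A X Y \<oplus> f = f" "f \<oplus> hzero A X Y = f"
proof -
  interpret H: comm_group "hom_group A X Y"
    by (rule hom_comm_group) (use assms in \<open>auto simp: src_obj tgt_obj\<close>)
  show "hzero A X Y \<oplus> f = f" "f \<oplus> hzero A X Y = f"
    using H.l_one[of f] H.r_one[of f] assms by (auto simp: hom_group_def Hom_def)
qed

lemma add_neg [simp]:
  assumes "f \<in> arr A"
  shows "f \<oplus> neg f = hzero A (src A f) (tgt A f)" "neg f \<oplus> f = hzero A (src A f) (tgt A f)"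
proof -
  interpret H: comm_group "hom_group A (src A f) (tgt A f)"
    by (rule hom_comm_group) (use assms in \<open>auto simp: src_obj tgt_obj\<close>)
  show "f \<oplus> neg f = hzero A (src A f) (tgt A f)" "neg f \<oplus> f = hzero A (src A f) (tgt A f)"
    using H.r_inv[of f] H.l_inv[of f] assms by (auto simp: hom_group_def Hom_def neg_def)
qed

lemma add_neg_left [simp]:
  assumes "f \<in> arr A" "g \<in> arr A" "src A g = src A f" "tgt A g = tgt A f"
  shows "f \<oplus> (neg f \<oplus> g) = g" "neg f \<oplus> (f \<oplus> g) = g"
  using assms by (auto simp: add_assoc[symmetric])

lemma add_left_cancel:
  assumes "f \<in> arr A" "g \<in> arr A" "h \<in> arr A" "src A g = src A f" "tgt A g = tgt A f"
    "src A h = src A f" "tgt A h = tgt A f"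
  shows "f \<oplus> g = f \<oplus> h \<longleftrightarrow> g = h"
  using assms add_neg_left(2)[of f g] add_neg_left(2)[of f h] by metis

lemma comp_add:
  assumes "f \<in> arr A" "g \<in> arr A" "h \<in> arr A" "src A g = src A f" "tgt A g = tgt A f"
    "src A h = tgt A f"
  shows "h \<cdot> (f \<oplus> g) = h \<cdot> f \<oplus> h \<cdot> g"
  using assms by (intro comp_hadd_right[of f "src A f" "tgt A f" g h "tgt A h"]) (auto simp: Hom_def)

lemma add_comp:
  assumes "f \<in> arr A" "g \<in> arr A" "h \<in> arr A" "src A g = src A f" "tgt A g = tgt A f"
    "src A f = tgt A h"
  shows "(f \<oplus> g) \<cdot> h = f \<cdot> h \<oplus> g \<cdot> h"
  using assms by (intro comp_hadd_left[of h "src A h" "tgt A h" f "tgt A f" g]) (auto simp: Hom_def)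

lemma comp_zero [simp]:
  assumes "f \<in> arr A" "src A f = Y" "X \<in> obj A"
  shows "f \<cdot> hzero A X Y = hzero A X (tgt A f)"
proof -
  let ?z = "hzero A X Y"
  have Y: "Y \<in> obj A" using assms src_obj by auto
  have "f \<cdot> ?z \<oplus> f \<cdot> ?z = f \<cdot> ?z \<oplus> hzero A X (tgt A f)"
    using assms Y by (simp add: comp_add[symmetric] tgt_obj)
  then show ?thesis using assms Y by (subst (asm) add_left_cancel) (auto simp: tgt_obj)
qed

lemma zero_comp [simp]:
  assumes "f \<in> arr A" "tgt A f = X" "Y \<in> obj A"
  shows "hzero A X Y \<cdot> f = hzero A (src A f) Y"
proof -
  let ?z = "hzero A X Y"
  have X: "X \<in> obj A" using assms tgt_obj by auto
  have "?z \<cdot> f \<oplus> ?z \<cdot> f = ?z \<cdot> f \<oplus> hzero A (src A f) Y"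
    using assms X by (simp add: add_comp[symmetric] src_obj)
  then show ?thesis using assms X by (subst (asm) add_left_cancel) (auto simp: src_obj)
qed

lemma neg_unique:
  assumes "f \<in> arr A" "g \<in> arr A" "src A g = src A f" "tgt A g = tgt A f"
    "f \<oplus> g = hzero A (src A f) (tgt A f)"
  shows "g = neg f"
proof -
  have "f \<oplus> g = f \<oplus> neg f" using assms by simp
  then show ?thesis using assms by (subst (asm) add_left_cancel) auto
qed

lemma comp_neg:
  assumes "f \<in> arr A" "g \<in> arr A" "src A g = tgt A f"
  shows "g \<cdot> neg f = neg (g \<cdot> f)"
  using assms by (intro neg_unique) (auto simp: comp_add[symmetric] src_obj)

lemma neg_comp:
  assumes "f \<in> arr A" "g \<in> arr A" "src A g = tgt A f"
  shows "neg g \<cdot> f = neg (g \<cdot> f)"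
  using assms by (intro neg_unique) (auto simp: add_comp[symmetric] tgt_obj)

lemma add_neg_eq_zero:
  assumes "f \<in> arr A" "g \<in> arr A" "src A g = src A f" "tgt A g = tgt A f"
    "f \<oplus> neg g = hzero A (src A f) (tgt A f)"
  shows "f = g"
proof -
  have "neg g \<oplus> f = neg g \<oplus> g" using assms by (simp add: add_commute)
  then show ?thesis using assms by (subst (asm) add_left_cancel) auto
qed

end

section \<open>Kernels and cokernels\<close>

context preadditive_category
begin

lemma is_kernelD:
  assumes "is_kernel A f k"
  shows "f \<in> arr A" "k \<in> arr A" "tgt A k = src A f" "f \<cdot> k = hzero A (src A k) (tgt A f)"
  using assms by (auto simp: is_kernel_def)

lemma is_kernel_lift:
  assumes "is_kernel A f k" "h \<in> arr A" "tgt A h = src A f" "f \<cdot> h = hzero A (src A h) (tgt A f)"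
  obtains u where "u \<in> arr A" "src A u = src A h" "tgt A u = src A k" "k \<cdot> u = h"
proof -
  have "h \<in> Hom A (src A h) (src A f)" using assms by (simp add: Hom_def)
  then have "\<exists>!u. u \<in> Hom A (src A h) (src A k) \<and> k \<cdot> u = h"
    using assms src_obj[OF assms(2)] by (simp add: is_kernel_def)
  then show ?thesis using that by (auto simp: Hom_def)
qed

lemma is_cokernelD:
  assumes "is_cokernel A f c"
  shows "f \<in> arr A" "c \<in> arr A" "src A c = tgt A f" "c \<cdot> f = hzero A (src A f) (tgt A c)"
  using assms by (auto simp: is_cokernel_def)

lemma is_cokernel_lift:
  assumes "is_cokernel A f c" "h \<in> arr A" "src A h = tgt A f" "h \<cdot> f = hzero A (src A f) (tgt A h)"
  obtains u where "u \<in> arr A" "src A u = tgt A c" "tgt A u = tgt A h" "u \<cdot> c = h"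
proof -
  have "h \<in> Hom A (tgt A f) (tgt A h)" using assms by (simp add: Hom_def)
  then have "\<exists>!u. u \<in> Hom A (tgt A c) (tgt A h) \<and> u \<cdot> c = h"
    using assms tgt_obj[OF assms(2)] by (simp add: is_cokernel_def)
  then show ?thesis using that by (auto simp: Hom_def)
qed

lemma is_epi_iff:
  assumes "f \<in> arr A"
  shows "is_epi A f \<longleftrightarrow> (\<forall>g\<in>arr A. src A g = tgt A f \<longrightarrow>
    g \<cdot> f = hzero A (src A f) (tgt A g) \<longrightarrow> g = hzero A (tgt A f) (tgt A g))"
    (is "_ \<longleftrightarrow> ?R")
proof
  assume epi: "is_epi A f"
  show ?R
  proof (intro ballI impI)
    fix g assume g: "g \<in> arr A" "src A g = tgt A f" "g \<cdot> f = hzero A (src A f) (tgt A g)"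
    then have "g \<cdot> f = hzero A (tgt A f) (tgt A g) \<cdot> f" using assms by (simp add: tgt_obj)
    then show "g = hzero A (tgt A f) (tgt A g)"
      using epi g assms unfolding is_epi_def
      by (auto simp: Hom_def tgt_obj dest!: bspec[of _ _ "tgt A g"])
  qed
next
  assume R: ?R
  show "is_epi A f" unfolding is_epi_def
  proof (intro conjI assms ballI impI)
    fix W g h assume W: "W \<in> obj A" and gh: "g \<in> Hom A (tgt A f) W" "h \<in> Hom A (tgt A f) W"
      and eq: "g \<cdot> f = h \<cdot> f"
    have "(g \<oplus> neg h) \<cdot> f = hzero A (src A f) W"
      using gh assms eq by (simp add: Hom_def add_comp neg_comp)
    then have "g \<oplus> neg h = hzero A (tgt A f) W"
      using R[rule_format, of "g \<oplus> neg h"] gh assms by (simp add: Hom_def)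
    then show "g = h" using gh by (simp add: Hom_def add_neg_eq_zero)
  qed
qed

lemma is_mono_iff:
  assumes "f \<in> arr A"
  shows "is_mono A f \<longleftrightarrow> (\<forall>g\<in>arr A. tgt A g = src A f \<longrightarrow>
    f \<cdot> g = hzero A (src A g) (tgt A f) \<longrightarrow> g = hzero A (src A g) (src A f))"
    (is "_ \<longleftrightarrow> ?R")
proof
  assume mono: "is_mono A f"
  show ?R
  proof (intro ballI impI)
    fix g assume g: "g \<in> arr A" "tgt A g = src A f" "f \<cdot> g = hzero A (src A g) (tgt A f)"
    then have "f \<cdot> g = f \<cdot> hzero A (src A g) (src A f)" using assms by (simp add: src_obj)
    then show "g = hzero A (src A g) (src A f)"
      using mono g assms unfolding is_mono_def
      by (auto simp: Hom_def src_obj dest!: bspec[of _ _ "src A g"])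
  qed
next
  assume R: ?R
  show "is_mono A f" unfolding is_mono_def
  proof (intro conjI assms ballI impI)
    fix W g h assume W: "W \<in> obj A" and gh: "g \<in> Hom A W (src A f)" "h \<in> Hom A W (src A f)"
      and eq: "f \<cdot> g = f \<cdot> h"
    have "f \<cdot> (g \<oplus> neg h) = hzero A W (tgt A f)"
      using gh assms eq by (simp add: Hom_def comp_add comp_neg)
    then have "g \<oplus> neg h = hzero A W (src A f)"
      using R[rule_format, of "g \<oplus> neg h"] gh assms by (simp add: Hom_def)
    then show "g = h" using gh by (simp add: Hom_def add_neg_eq_zero)
  qed
qed

lemma is_epi_cancel:
  assumes "is_epi A f" "g \<in> arr A" "h \<in> arr A" "src A g = tgt A f" "src A h = tgt A f"
    "tgt A g = tgt A h" "g \<cdot> f = h \<cdot> f"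
  shows "g = h"
  using assms tgt_obj[of h] unfolding is_epi_def by (auto simp: Hom_def)

lemma is_mono_cancel:
  assumes "is_mono A f" "g \<in> arr A" "h \<in> arr A" "tgt A g = src A f" "tgt A h = src A f"
    "src A g = src A h" "f \<cdot> g = f \<cdot> h"
  shows "g = h"
  using assms src_obj[of h] unfolding is_mono_def by (auto simp: Hom_def)

lemma cokernel_epi:
  assumes "is_cokernel A f c"
  shows "is_epi A c"
proof -
  note c = is_cokernelD[OF assms]
  show ?thesis unfolding is_epi_def
  proof (intro conjI c(2) ballI impI)
    fix W g h assume W: "W \<in> obj A" and gh: "g \<in> Hom A (tgt A c) W" "h \<in> Hom A (tgt A c) W"
      and eq: "g \<cdot> c = h \<cdot> c"
    have "g \<cdot> c \<in> Hom A (tgt A f) W" "(g \<cdot> c) \<cdot> f = hzero A (src A f) W"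
      using gh c by (auto simp: Hom_def comp_assoc_arr src_obj)
    then have "\<exists>!u. u \<in> Hom A (tgt A c) W \<and> u \<cdot> c = g \<cdot> c"
      using assms W unfolding is_cokernel_def by blast
    then show "g = h" using gh eq by metis
  qed
qed

lemma kernel_mono:
  assumes "is_kernel A f k"
  shows "is_mono A k"
proof -
  note k = is_kernelD[OF assms]
  show ?thesis unfolding is_mono_def
  proof (intro conjI k(2) ballI impI)
    fix W g h assume W: "W \<in> obj A" and gh: "g \<in> Hom A W (src A k)" "h \<in> Hom A W (src A k)"
      and eq: "k \<cdot> g = k \<cdot> h"
    have "k \<cdot> g \<in> Hom A W (src A f)" "f \<cdot> (k \<cdot> g) = hzero A W (tgt A f)"
      using gh k by (auto simp: Hom_def comp_assoc_arr[symmetric] tgt_obj)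
    then have "\<exists>!u. u \<in> Hom A W (src A k) \<and> k \<cdot> u = k \<cdot> g"
      using assms W unfolding is_kernel_def by blast
    then show "g = h" using gh eq by metis
  qed
qed

text \<open>Uniqueness of the factorization is supplied by \<open>is_epi\<close>, which leaves only
  its existence to be shown.\<close>

lemma is_cokernelI:
  assumes "f \<in> arr A" "is_epi A c" "src A c = tgt A f" "c \<cdot> f = hzero A (src A f) (tgt A c)"
    and "\<And>h. h \<in> arr A \<Longrightarrow> src A h = tgt A f \<Longrightarrow> h \<cdot> f = hzero A (src A f) (tgt A h) \<Longrightarrow>
      \<exists>u. u \<in> Hom A (tgt A c) (tgt A h) \<and> u \<cdot> c = h"
  shows "is_cokernel A f c"
  unfolding is_cokernel_def
proof (intro conjI ballI impI)
  fix W h assume "W \<in> obj A" "h \<in> Hom A (tgt A f) W" "h \<cdot> f = hzero A (src A f) W"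
  then obtain u where "u \<in> Hom A (tgt A c) W \<and> u \<cdot> c = h"
    using assms(5)[of h] by (auto simp: Hom_def)
  then show "\<exists>!u. u \<in> Hom A (tgt A c) W \<and> u \<cdot> c = h"
    using is_epi_cancel[OF assms(2)] by (auto simp: Hom_def)
qed (use assms in \<open>auto simp: is_epi_def\<close>)

lemma is_kernelI:
  assumes "f \<in> arr A" "is_mono A k" "tgt A k = src A f" "f \<cdot> k = hzero A (src A k) (tgt A f)"
    and "\<And>h. h \<in> arr A \<Longrightarrow> tgt A h = src A f \<Longrightarrow> f \<cdot> h = hzero A (src A h) (tgt A f) \<Longrightarrow>
      \<exists>u. u \<in> Hom A (src A h) (src A k) \<and> k \<cdot> u = h"
  shows "is_kernel A f k"
  unfolding is_kernel_def
proof (intro conjI ballI impI)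
  fix W h assume "W \<in> obj A" "h \<in> Hom A W (src A f)" "f \<cdot> h = hzero A W (tgt A f)"
  then obtain u where "u \<in> Hom A W (src A k) \<and> k \<cdot> u = h"
    using assms(5)[of h] by (auto simp: Hom_def)
  then show "\<exists>!u. u \<in> Hom A W (src A k) \<and> k \<cdot> u = h"
    using is_mono_cancel[OF assms(2)] by (auto simp: Hom_def)
qed (use assms in \<open>auto simp: is_mono_def\<close>)

text \<open>\<open>f\<close> factors through the kernel \<open>k\<close>, so every arrow that kills
  \<open>k\<close> also kills \<open>f\<close> and therefore factors through
  \<open>c\<close>.\<close>

lemma cokernel_of_its_kernel:
  assumes c: "is_cokernel A f c" and k: "is_kernel A c k"
  shows "is_cokernel A k c"
proof (rule is_cokernelI)
  note c' = is_cokernelD[OF c] and k' = is_kernelD[OF k]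
  show "k \<in> arr A" "is_epi A c" "src A c = tgt A k" "c \<cdot> k = hzero A (src A k) (tgt A c)"
    using k' cokernel_epi[OF c] by auto
  fix h assume h: "h \<in> arr A" "src A h = tgt A k" "h \<cdot> k = hzero A (src A k) (tgt A h)"
  obtain e where e: "e \<in> arr A" "src A e = src A f" "tgt A e = src A k" "k \<cdot> e = f"
    using is_kernel_lift[OF k c'(1)] c' by auto
  have "h \<cdot> f = hzero A (src A f) (tgt A h)"
    unfolding e(4)[symmetric] using h e(1-3) k' by (simp add: comp_assoc_arr[symmetric] tgt_obj)
  then obtain u where "u \<in> arr A" "src A u = tgt A c" "tgt A u = tgt A h" "u \<cdot> c = h"
    using is_cokernel_lift[OF c, of h] h c' k' by auto
  then show "\<exists>u. u \<in> Hom A (tgt A c) (tgt A h) \<and> u \<cdot> c = h" by (auto simp: Hom_def)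
qed

lemma is_zero_object_hom:
  assumes "is_zero_object A Z" "f \<in> arr A"
  shows "src A f = Z \<Longrightarrow> f = hzero A Z (tgt A f)" "tgt A f = Z \<Longrightarrow> f = hzero A (src A f) Z"
proof -
  have Z: "Z \<in> obj A" using assms by (simp add: is_zero_object_def)
  have ex: "\<exists>!g. g \<in> Hom A Z X" "\<exists>!g. g \<in> Hom A X Z" if "X \<in> obj A" for X
    using assms that by (auto simp: is_zero_object_def)
  show "src A f = Z \<Longrightarrow> f = hzero A Z (tgt A f)"
    using ex(1)[OF tgt_obj[OF assms(2)]] assms Z by (auto simp: Hom_def tgt_obj)
  show "tgt A f = Z \<Longrightarrow> f = hzero A (src A f) Z"
    using ex(2)[OF src_obj[OF assms(2)]] assms Z by (auto simp: Hom_def src_obj)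
qed

lemma zero_kernel_of_mono:
  assumes Z: "is_zero_object A Z" and f: "is_mono A f"
  shows "is_kernel A f (hzero A Z (src A f))"
proof -
  have f': "f \<in> arr A" using f by (simp add: is_mono_def)
  have Z': "Z \<in> obj A" using Z by (simp add: is_zero_object_def)
  show ?thesis
  proof (rule is_kernelI)
    have "g = hzero A (src A g) Z" if "g \<in> arr A" "tgt A g = Z" for g
      using is_zero_object_hom(2)[OF Z] that by simp
    then show "is_mono A (hzero A Z (src A f))" using f' Z' by (subst is_mono_iff) (auto simp: src_obj)
    fix h assume h: "h \<in> arr A" "tgt A h = src A f" "f \<cdot> h = hzero A (src A h) (tgt A f)"
    then have "h = hzero A (src A h) (src A f)" using f f' is_mono_iff by auto
    also have "\<dots> = hzero A Z (src A f) \<cdot> hzero A (src A h) Z"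
      using f' Z' h by (simp add: src_obj)
    finally show "\<exists>u. u \<in> Hom A (src A h) (src A (hzero A Z (src A f))) \<and>
        hzero A Z (src A f) \<cdot> u = h"
      using f' h Z' by (intro exI[of _ "hzero A (src A h) Z"]) (auto simp: Hom_def src_obj)
  qed (use f' Z' in \<open>auto simp: src_obj\<close>)
qed

lemma zero_cokernel_of_epi:
  assumes Z: "is_zero_object A Z" and f: "is_epi A f"
  shows "is_cokernel A f (hzero A (tgt A f) Z)"
proof -
  have f': "f \<in> arr A" using f by (simp add: is_epi_def)
  have Z': "Z \<in> obj A" using Z by (simp add: is_zero_object_def)
  show ?thesis
  proof (rule is_cokernelI)
    have "g = hzero A Z (tgt A g)" if "g \<in> arr A" "src A g = Z" for g
      using is_zero_object_hom(1)[OF Z] that by simp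
    then show "is_epi A (hzero A (tgt A f) Z)" using f' Z' by (subst is_epi_iff) (auto simp: tgt_obj)
    fix h assume h: "h \<in> arr A" "src A h = tgt A f" "h \<cdot> f = hzero A (src A f) (tgt A h)"
    then have "h = hzero A (tgt A f) (tgt A h)" using f f' is_epi_iff by auto
    also have "\<dots> = hzero A Z (tgt A h) \<cdot> hzero A (tgt A f) Z"
      using f' Z' h by (simp add: tgt_obj)
    finally show "\<exists>u. u \<in> Hom A (tgt A (hzero A (tgt A f) Z)) (tgt A h) \<and>
        u \<cdot> hzero A (tgt A f) Z = h"
      using f' h Z' by (intro exI[of _ "hzero A Z (tgt A h)"]) (auto simp: Hom_def tgt_obj)
  qed (use f' Z' in \<open>auto simp: tgt_obj\<close>)
qed

lemma mono_if_zero_kernel: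
  assumes Z: "is_zero_object A (src A k)" and k: "is_kernel A f k"
  shows "is_mono A f"
proof (subst is_mono_iff[OF is_kernelD(1)[OF k]], intro ballI impI)
  note k' = is_kernelD[OF k]
  fix g assume g: "g \<in> arr A" "tgt A g = src A f" "f \<cdot> g = hzero A (src A g) (tgt A f)"
  obtain u where u: "u \<in> arr A" "src A u = src A g" "tgt A u = src A k" "k \<cdot> u = g"
    using is_kernel_lift[OF k g] .
  have "k = hzero A (src A k) (src A f)" using is_zero_object_hom(1)[OF Z k'(2)] k' by simp
  then show "g = hzero A (src A g) (src A f)" using u k' zero_comp[OF u(1,3), of "src A f"]
    by (metis src_obj)
qed

lemma epi_if_zero_cokernel:
  assumes Z: "is_zero_object A (tgt A c)" and c: "is_cokernel A f c"
  shows "is_epi A f"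
proof (subst is_epi_iff[OF is_cokernelD(1)[OF c]], intro ballI impI)
  note c' = is_cokernelD[OF c]
  fix g assume g: "g \<in> arr A" "src A g = tgt A f" "g \<cdot> f = hzero A (src A f) (tgt A g)"
  obtain u where u: "u \<in> arr A" "src A u = tgt A c" "tgt A u = tgt A g" "u \<cdot> c = g"
    using is_cokernel_lift[OF c g] .
  have "c = hzero A (tgt A f) (tgt A c)" using is_zero_object_hom(2)[OF Z c'(2)] c' by simp
  then show "g = hzero A (tgt A f) (tgt A g)" using u c' comp_zero[OF u(1,2), of "tgt A f"]
    by (metis tgt_obj)
qed

end

section \<open>Isomorphisms and images in abelian categories\<close>

context abelian_category
begin

text \<open>Normality makes \<open>f\<close> the kernel of some \<open>g\<close>. As
  \<open>f\<close> is epi and g f = 0, this \<open>g\<close> vanishes, so the identity of the target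
  factors through \<open>f\<close>. The resulting right inverse is also a left inverse because
  \<open>f\<close> can be cancelled on the left.\<close>

lemma mono_epi_iso:
  assumes f: "is_mono A f" "is_epi A f"
  obtains r where "r \<in> Hom A (tgt A f) (src A f)" "f \<cdot> r = ident A (tgt A f)"
    "r \<cdot> f = ident A (src A f)"
proof -
  have f': "f \<in> arr A" using f by (simp add: is_mono_def)
  obtain g where g: "is_kernel A g f" using monos_normal[OF f(1)] by auto
  note g' = is_kernelD[OF g]
  have "g = hzero A (tgt A f) (tgt A g)" using f(2) g' is_epi_iff[OF f'] by auto
  then have "g \<cdot> ident A (tgt A f) = hzero A (src A (ident A (tgt A f))) (tgt A g)"
    using g' f' by (metis comp_ident_arr ident_simps(2) tgt_obj)
  then obtain r where r: "r \<in> arr A" "src A r = tgt A f" "tgt A r = src A f"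
      "f \<cdot> r = ident A (tgt A f)"
    using is_kernel_lift[OF g, of "ident A (tgt A f)"] g' by (auto simp: src_obj)
  have "f \<cdot> (r \<cdot> f) = f \<cdot> ident A (src A f)"
    using r f' by (simp add: comp_assoc_arr[symmetric] src_obj)
  then have "r \<cdot> f = ident A (src A f)"
    using is_mono_cancel[OF f(1), of "r \<cdot> f" "ident A (src A f)"] r f' by (simp add: src_obj)
  with r show ?thesis by (intro that[of r]) (auto simp: Hom_def)
qed

text \<open>Here \<open>m\<close>, the kernel of the cokernel of \<open>d\<close>, is the image of
  \<open>d\<close>, and the claim is that \<open>d\<close> maps epimorphically onto it. If
  \<open>v\<close> kills \<open>e\<close>, then \<open>d\<close> factors through the smaller
  subobject \<open>m \<cdot> k\<close> with \<open>k\<close> the kernel of \<open>v\<close>.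
  Minimality of the image then forces \<open>k\<close> to have a right inverse, whence
  \<open>v\<close> = 0.\<close>

lemma image_factorization:
  assumes f: "is_cokernel A d q" and m: "is_kernel A q m"
    and e: "e \<in> Hom A (src A d) (src A m)" and me: "m \<cdot> e = d"
  shows "is_epi A e"
proof -
  note q' = is_cokernelD[OF f] and m' = is_kernelD[OF m]
  have e': "e \<in> arr A" "src A e = src A d" "tgt A e = src A m" using e by (auto simp: Hom_def)
  show ?thesis
  proof (subst is_epi_iff[OF e'(1)], intro ballI impI)
    fix v assume v: "v \<in> arr A" "src A v = tgt A e" "v \<cdot> e = hzero A (src A e) (tgt A v)"
    obtain k where k: "is_kernel A v k" using kernels[OF v(1)] by auto
    note k' = is_kernelD[OF k]
    obtain e2 where e2: "e2 \<in> arr A" "src A e2 = src A e" "tgt A e2 = src A k" "k \<cdot> e2 = e"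
      using is_kernel_lift[OF k, of e] v e' by auto
    have mk: "is_mono A (m \<cdot> k)" unfolding is_mono_def
    proof (intro conjI ballI impI)
      fix W x y assume xy: "x \<in> Hom A W (src A (m \<cdot> k))" "y \<in> Hom A W (src A (m \<cdot> k))"
        "(m \<cdot> k) \<cdot> x = (m \<cdot> k) \<cdot> y"
      then have "m \<cdot> (k \<cdot> x) = m \<cdot> (k \<cdot> y)"
        using m' k' v e' by (simp add: comp_assoc_arr Hom_def)
      then have "k \<cdot> x = k \<cdot> y"
        using is_mono_cancel[OF kernel_mono[OF m], of "k \<cdot> x" "k \<cdot> y"] xy m' k' v e'
        by (simp add: Hom_def)
      then show "x = y"
        using is_mono_cancel[OF kernel_mono[OF k], of x y] xy m' k' v e' by (simp add: Hom_def)
    qed (use m' k' v e' in simp)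
    \<comment> \<open>Normality turns the subobject \<open>m \<cdot> k\<close> into a kernel. Its
      arrow \<open>w\<close> kills \<open>d\<close>, hence factors through \<open>q\<close> and
      kills \<open>m\<close>; so \<open>m\<close> in turn factors through
      \<open>m \<cdot> k\<close>.\<close>
    obtain w where w: "is_kernel A w (m \<cdot> k)" using monos_normal[OF mk] by auto
    note w' = is_kernelD[OF w]
    have sw: "src A w = tgt A m" using w' m' k' v e' by simp
    have "d = (m \<cdot> k) \<cdot> e2"
      using me e2(4) comp_assoc_arr[of e2 k m] e2(1-3) k' m' v(1,2) e' by simp
    then have "w \<cdot> d = (w \<cdot> (m \<cdot> k)) \<cdot> e2"
      using comp_assoc_arr[of e2 "m \<cdot> k" w] w'(1,2) m' k'(1-3) v(1,2) e' e2(1-3) sw by simp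
    also have "\<dots> = hzero A (src A d) (tgt A w)"
      using w' m' k' v e' e2 sw by (simp add: tgt_obj)
    finally obtain w2 where w2: "w2 \<in> arr A" "src A w2 = tgt A q" "tgt A w2 = tgt A w" "w2 \<cdot> q = w"
      using is_cokernel_lift[OF f w'(1)] sw q' m' by auto
    have "w \<cdot> m = hzero A (src A m) (tgt A w)"
      using comp_assoc_arr[of m q w2] comp_zero[of w2 "tgt A q" "src A m"] w2 q' m'
      by (simp add: src_obj)
    then obtain r where r: "r \<in> arr A" "src A r = src A m" "tgt A r = src A (m \<cdot> k)" "(m \<cdot> k) \<cdot> r = m"
      using is_kernel_lift[OF w m'(2)] sw by auto
    have r3: "tgt A r = src A k" using r(3) m' k' v e' by simp
    have "m \<cdot> (k \<cdot> r) = m \<cdot> ident A (src A m)"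
      using r r3 m' k' v e' by (simp add: comp_assoc_arr[symmetric] src_obj)
    then have kr: "k \<cdot> r = ident A (src A m)"
      using is_mono_cancel[OF kernel_mono[OF m], of "k \<cdot> r" "ident A (src A m)"] r r3 m' k' v e'
      by (simp add: src_obj)
    have "v = v \<cdot> (k \<cdot> r)" unfolding kr using v e' by simp
    also have "\<dots> = (v \<cdot> k) \<cdot> r" using v(1,2) k'(1-3) r(1,2) r3 by (simp add: comp_assoc_arr)
    also have "\<dots> = hzero A (tgt A e) (tgt A v)"
      using v(1,2) e' k' r(1,2) r3 by (simp add: tgt_obj)
    finally show "v = hzero A (tgt A e) (tgt A v)" .
  qed
qed

end

section \<open>Countable products\<close>

lemma (in category) countable_product_exists:
  fixes \<Lambda> :: "'u rel"
  assumes "inaccessible_cardinal \<Lambda>" "has_small_products \<Lambda> C" "\<And>j :: nat. X j \<in> obj C"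
  obtains P p where "is_product C UNIV X P p"
proof -
  obtain e :: "nat \<Rightarrow> 'u" where e: "inj e" "small \<Lambda> (range e)"
    using inaccessible_countable[OF assms(1)] .
  obtain P p where P: "is_product C (range e) (\<lambda>i. X (inv_into UNIV e i)) P p"
    using assms(2)[unfolded has_small_products_def, rule_format, OF e(2),
        of "\<lambda>i. X (inv_into UNIV e i)"] assms(3) by blast
  have "is_product C UNIV (\<lambda>j. X (inv_into UNIV e (e j))) P (\<lambda>j. p (e j))"
    by (rule is_product_reindex[OF _ P]) (use e in \<open>simp add: bij_betw_def\<close>)
  then show ?thesis using that e(1) by simp
qed

text \<open>The three products over \<open>nat\<close> are reindexed to products over the small set
  \<open>range e\<close>, where the exactness hypothesis applies. The objects and the arrows
  \<open>F\<close>, \<open>G\<close> stay the same.\<close>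

lemma (in preadditive_category) exact_countable_products:
  fixes \<Lambda> :: "'u rel"
  assumes \<Lambda>: "inaccessible_cardinal \<Lambda>" and ex: "has_exact_small_products \<Lambda> A"
    and fg: "\<And>j :: nat. f j \<in> Hom A (X j) (Y j)" "\<And>j. g j \<in> Hom A (Y j) (Z j)"
      "\<And>j. short_exact A (f j) (g j)"
    and P: "is_product A UNIV X P p" and Q: "is_product A UNIV Y Q q"
    and R: "is_product A UNIV Z R s"
    and F: "F \<in> Hom A P Q" "\<And>j. q j \<cdot> F = f j \<cdot> p j"
    and G: "G \<in> Hom A Q R" "\<And>j. s j \<cdot> G = g j \<cdot> q j"
  shows "short_exact A F G"
proof -
  obtain e :: "nat \<Rightarrow> 'u" where e: "inj e" "small \<Lambda> (range e)"
    using inaccessible_countable[OF \<Lambda>] .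
  have bij: "bij_betw (inv_into UNIV e) (range e) UNIV"
    using e(1) by (auto simp: bij_betw_def inj_on_def image_image)
  note ex' = ex[unfolded has_exact_small_products_def, THEN conjunct2, rule_format]
  let ?e = "inv_into UNIV e"
  show ?thesis
    by (rule ex'[where I = "range e" and f = "\<lambda>i. f (?e i)" and g = "\<lambda>i. g (?e i)",
          OF e(2) _ is_product_reindex[OF bij P] is_product_reindex[OF bij Q]
          is_product_reindex[OF bij R] F(1) F(2) G(1) G(2)]) (use fg in auto)
qed

text \<open>Exactness of products is stated for short exact sequences, but the \<open>d j\<close>
  need not be mono. Each is therefore cut at its image: ker e -> X -> im and im -> Y -> coker are
  short exact. The products of these give an epi \<open>E'\<close> and an arrow \<open>M\<close>
  with cokernel \<open>E\<close>, and precomposing \<open>M\<close> with an epi does not change its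
  cokernel.\<close>

lemma (in abelian_category) product_of_cokernels:
  assumes \<Lambda>: "inaccessible_cardinal \<Lambda>" and ex: "has_exact_small_products \<Lambda> A"
    and d: "\<And>j :: nat. d j \<in> Hom A (X j) (Y j)" and c: "\<And>j. is_cokernel A (d j) (c j)"
    and P: "is_product A UNIV X P p" and Q: "is_product A UNIV Y Q q"
    and R: "is_product A UNIV (\<lambda>j. tgt A (c j)) R s"
    and D: "D \<in> Hom A P Q" "\<And>j. q j \<cdot> D = d j \<cdot> p j"
    and E: "E \<in> Hom A Q R" "\<And>j. s j \<cdot> E = c j \<cdot> q j"
  shows "is_cokernel A D E"
proof -
  have prods: "has_small_products \<Lambda> A" using ex by (simp add: has_exact_small_products_def)
  note c' = is_cokernelD[OF c]
  have d': "d j \<in> arr A" "src A (d j) = X j" "tgt A (d j) = Y j" for j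
    using d by (auto simp: Hom_def)
  have "\<forall>j. \<exists>m. is_kernel A (c j) m" using kernels c' by auto
  then obtain m where m: "\<And>j. is_kernel A (c j) (m j)" by metis
  note m' = is_kernelD[OF m]
  have "\<exists>e. e \<in> Hom A (src A (d j)) (src A (m j)) \<and> m j \<cdot> e = d j" for j
    by (rule is_kernel_lift[OF m[of j] c'(1)[of j]]) (use c'[of j] in \<open>auto simp: Hom_def\<close>)
  then obtain e where e: "\<And>j. e j \<in> Hom A (src A (d j)) (src A (m j))" "\<And>j. m j \<cdot> e j = d j"
    by metis
  have e': "e j \<in> arr A" "src A (e j) = X j" "tgt A (e j) = src A (m j)" for j
    using e d' by (auto simp: Hom_def)
  have epi: "is_epi A (e j)" for j by (rule image_factorization[OF c m e])
  have "\<forall>j. \<exists>k. is_kernel A (e j) k" using kernels e' by auto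
  then obtain k where k: "\<And>j. is_kernel A (e j) (k j)" by metis
  note k' = is_kernelD[OF k]
  \<comment> \<open>The epi \<open>e j\<close> is the cokernel of some arrow, hence the cokernel of
    its own kernel.\<close>
  have se1: "short_exact A (k j) (e j)" for j
    using epis_normal[OF epi[of j]] k cokernel_of_its_kernel by (auto simp: short_exact_def)
  have se2: "short_exact A (m j) (c j)" for j
    using m cokernel_of_its_kernel[OF c m] by (simp add: short_exact_def)
  obtain PI pI where PI: "is_product A UNIV (\<lambda>j. src A (m j)) PI pI"
    using countable_product_exists[OF \<Lambda> prods, of "\<lambda>j. src A (m j)"] m' src_obj by blast
  obtain PK pK where PK: "is_product A UNIV (\<lambda>j. src A (k j)) PK pK"
    using countable_product_exists[OF \<Lambda> prods, of "\<lambda>j. src A (k j)"] k' src_obj by blast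
  note PIo = is_productD[OF PI] and PKo = is_productD[OF PK] and Po = is_productD[OF P]
    and Qo = is_productD[OF Q]
  obtain E' where E': "E' \<in> Hom A P PI" "\<And>j. pI j \<cdot> E' = e j \<cdot> p j"
    using is_product_lift[OF PI Po(1), of "\<lambda>j. e j \<cdot> p j"] Po(2) e' by (auto simp: Hom_def)
  obtain M where M: "M \<in> Hom A PI Q" "\<And>j. q j \<cdot> M = m j \<cdot> pI j"
    using is_product_lift[OF Q PIo(1), of "\<lambda>j. m j \<cdot> pI j"] PIo(2) m' c' d'
    by (auto simp: Hom_def)
  obtain K where K: "K \<in> Hom A PK P" "\<And>j. p j \<cdot> K = k j \<cdot> pK j"
    using is_product_lift[OF P PKo(1), of "\<lambda>j. k j \<cdot> pK j"] PKo(2) k' e' by (auto simp: Hom_def)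
  have "short_exact A K E'"
    by (rule exact_countable_products[OF \<Lambda> ex _ _ se1 PK P PI K E'])
      (use k' e' in \<open>auto simp: Hom_def\<close>)
  then have E'_epi: "is_epi A E'" using cokernel_epi by (auto simp: short_exact_def)
  have "short_exact A M E"
    by (rule exact_countable_products[OF \<Lambda> ex _ _ se2 PI Q R M E])
      (use m' c' d' in \<open>auto simp: Hom_def\<close>)
  then have ME: "is_cokernel A M E" by (simp add: short_exact_def)
  note ME' = is_cokernelD[OF ME]
  have arrs: "M \<in> arr A" "src A M = PI" "tgt A M = Q" "E' \<in> arr A" "src A E' = P" "tgt A E' = PI"
    "D \<in> arr A" "src A D = P" "tgt A D = Q" "src A E = Q" "tgt A E = R"
    using M E' D E by (auto simp: Hom_def)
  have MD: "M \<cdot> E' = D"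
  proof (rule is_product_eqI[OF Q _ D(1)])
    show "M \<cdot> E' \<in> Hom A P Q" using arrs by (simp add: Hom_def)
    fix j
    have pr: "q j \<in> arr A" "src A (q j) = Q" "tgt A (q j) = Y j"
        "pI j \<in> arr A" "src A (pI j) = PI" "tgt A (pI j) = src A (m j)"
        "p j \<in> arr A" "src A (p j) = P" "tgt A (p j) = X j"
      using PIo(2)[of j] Qo(2)[of j] Po(2)[of j] by (auto simp: Hom_def)
    have "q j \<cdot> (M \<cdot> E') = (m j \<cdot> pI j) \<cdot> E'"
      using arrs pr M(2)[of j] by (simp add: comp_assoc_arr[symmetric])
    also have "\<dots> = m j \<cdot> (e j \<cdot> p j)"
      using arrs pr m'[of j] E'(2)[of j] by (simp add: comp_assoc_arr)
    also have "\<dots> = q j \<cdot> D"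
      using arrs pr m'[of j] e'[of j] D(2)[of j] e(2)[of j] by (simp add: comp_assoc_arr[symmetric])
    finally show "q j \<cdot> (M \<cdot> E') = q j \<cdot> D" .
  qed
  show ?thesis
  proof (rule is_cokernelI)
    show "D \<in> arr A" "is_epi A E" "src A E = tgt A D" using arrs cokernel_epi[OF ME] by auto
    have "E \<cdot> D = (E \<cdot> M) \<cdot> E'" unfolding MD[symmetric]
      using arrs ME'(2) by (simp add: comp_assoc_arr)
    then show "E \<cdot> D = hzero A (src A D) (tgt A E)"
      using arrs ME' Po(1) is_productD(1)[OF R] by simp
    fix h assume h: "h \<in> arr A" "src A h = tgt A D" "h \<cdot> D = hzero A (src A D) (tgt A h)"
    have "(h \<cdot> M) \<cdot> E' = hzero A (src A E') (tgt A (h \<cdot> M))"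
      using h arrs MD by (simp add: comp_assoc_arr)
    then have "h \<cdot> M = hzero A (src A M) (tgt A h)"
      using E'_epi[unfolded is_epi_iff[OF arrs(4)], rule_format, of "h \<cdot> M"] arrs h by simp
    then show "\<exists>u. u \<in> Hom A (tgt A E) (tgt A h) \<and> u \<cdot> E = h"
      using is_cokernel_lift[OF ME h(1)] h(2) arrs by (auto simp: Hom_def)
  qed
qed

section \<open>Local inverse sequences\<close>

text \<open>By the Yoneda lemma this expresses invertibility of 1 - F whenever the product exists.
  Working with components avoids choosing a product and a shift.\<close>

definition uniquely_solvable :: "('o, 'm, 'x) preadd_cat_scheme \<Rightarrow> ('o, 'm) invseq \<Rightarrow> bool" where
  "uniquely_solvable A S \<longleftrightarrow> (\<forall>W\<in>obj A. \<forall>a. (\<forall>j. a j \<in> Hom A W (fst S j)) \<longrightarrow>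
    (\<exists>!x. \<forall>j. x j \<in> Hom A W (fst S j) \<and> x j = hadd A (a j) (snd S j \<cdot>\<^bsub>A\<^esub> x (Suc j))))"

lemma uniquely_solvable_obtain:
  assumes "uniquely_solvable A S" "W \<in> obj A" "\<And>j. a j \<in> Hom A W (fst S j)"
  obtains x where "\<And>j. x j \<in> Hom A W (fst S j)"
    "\<And>j. x j = hadd A (a j) (snd S j \<cdot>\<^bsub>A\<^esub> x (Suc j))"
proof -
  have "\<exists>!x. \<forall>j. x j \<in> Hom A W (fst S j) \<and> x j = hadd A (a j) (snd S j \<cdot>\<^bsub>A\<^esub> x (Suc j))"
    using assms by (simp add: uniquely_solvable_def)
  then obtain x where "\<forall>j. x j \<in> Hom A W (fst S j) \<and>
      x j = hadd A (a j) (snd S j \<cdot>\<^bsub>A\<^esub> x (Suc j))" by (rule ex1E)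
  then show ?thesis by (intro that[of x]) blast+
qed

lemma uniquely_solvable_unique:
  assumes "uniquely_solvable A S" "W \<in> obj A" "\<And>j. a j \<in> Hom A W (fst S j)"
    and "\<And>j. x j \<in> Hom A W (fst S j)" "\<And>j. x j = hadd A (a j) (snd S j \<cdot>\<^bsub>A\<^esub> x (Suc j))"
    and "\<And>j. y j \<in> Hom A W (fst S j)" "\<And>j. y j = hadd A (a j) (snd S j \<cdot>\<^bsub>A\<^esub> y (Suc j))"
  shows "x = y"
proof -
  have ex: "\<exists>!x. \<forall>j. x j \<in> Hom A W (fst S j) \<and> x j = hadd A (a j) (snd S j \<cdot>\<^bsub>A\<^esub> x (Suc j))"
    using assms(1-3) by (simp add: uniquely_solvable_def)
  have x: "\<forall>j. x j \<in> Hom A W (fst S j) \<and> x j = hadd A (a j) (snd S j \<cdot>\<^bsub>A\<^esub> x (Suc j))"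
    using assms(4,5) by blast
  have y: "\<forall>j. y j \<in> Hom A W (fst S j) \<and> y j = hadd A (a j) (snd S j \<cdot>\<^bsub>A\<^esub> y (Suc j))"
    using assms(6,7) by blast
  show ?thesis using trans[OF the1_equality[OF ex, of x, OF x, symmetric] the1_equality[OF ex, of y, OF y]] .
qed

section \<open>The equation (1 - F) x = a in components\<close>

context preadditive_category
begin

lemma shift_difference:
  assumes "is_shift A S P pr F"
  shows "hdiff A (ident A P) F \<in> Hom A P P"
    and "x \<in> Hom A W P \<Longrightarrow> hdiff A (ident A P) F \<cdot> x \<oplus> F \<cdot> x = x"
proof -
  have P: "P \<in> obj A" "F \<in> arr A" "src A F = P" "tgt A F = P"
    using assms is_productD(1) by (auto simp: is_shift_def Hom_def)
  show "hdiff A (ident A P) F \<in> Hom A P P"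
    using P by (simp add: hdiff_neg Hom_def)
  show "hdiff A (ident A P) F \<cdot> x \<oplus> F \<cdot> x = x" if "x \<in> Hom A W P"
    using P that by (simp add: hdiff_neg Hom_def add_comp neg_comp add_assoc)
qed

text \<open>The component \<open>j\<close> of F x is \<open>snd S j\<close> applied to component
  \<open>Suc j\<close> of x. Adding it to both sides of (1 - F) x = a, and testing on the
  projections, gives the system on the right.\<close>

lemma shift_difference_eq_iff:
  assumes S: "is_invseq A S" and sh: "is_shift A S P pr F"
    and xa: "x \<in> Hom A W P" "a \<in> Hom A W P"
  shows "hdiff A (ident A P) F \<cdot> x = a \<longleftrightarrow>
    (\<forall>j. pr j \<cdot> x = pr j \<cdot> a \<oplus> snd S j \<cdot> (pr (Suc j) \<cdot> x))"
proof -
  let ?G = "hdiff A (ident A P) F"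
  have P: "is_product A UNIV (fst S) P pr" "P \<in> obj A" "F \<in> arr A" "src A F = P" "tgt A F = P"
    and prF: "\<And>j. pr j \<cdot> F = snd S j \<cdot> pr (Suc j)"
    using sh is_productD(1) by (auto simp: is_shift_def Hom_def)
  have pr: "pr j \<in> arr A" "src A (pr j) = P" "tgt A (pr j) = fst S j" for j
    using is_productD(2)[OF P(1), of j] by (auto simp: Hom_def)
  have f: "snd S j \<in> arr A" "src A (snd S j) = fst S (Suc j)" "tgt A (snd S j) = fst S j" for j
    using S by (auto simp: is_invseq_def Hom_def)
  have xa': "x \<in> arr A" "src A x = W" "tgt A x = P" "a \<in> arr A" "src A a = W" "tgt A a = P"
    using xa by (auto simp: Hom_def)
  have G: "?G \<in> arr A" "src A ?G = P" "tgt A ?G = P"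
    using shift_difference(1)[OF sh] by (auto simp: Hom_def)
  have prFx: "pr j \<cdot> (F \<cdot> x) = snd S j \<cdot> (pr (Suc j) \<cdot> x)" for j
    using prF[of j] pr f xa' P by (simp add: comp_assoc_arr[symmetric])
  have prx: "pr j \<cdot> x = pr j \<cdot> (?G \<cdot> x) \<oplus> snd S j \<cdot> (pr (Suc j) \<cdot> x)" for j
  proof -
    have "pr j \<cdot> x = pr j \<cdot> (?G \<cdot> x \<oplus> F \<cdot> x)" using shift_difference(2)[OF sh xa(1)] by simp
    also have "\<dots> = pr j \<cdot> (?G \<cdot> x) \<oplus> pr j \<cdot> (F \<cdot> x)"
      using G P pr xa' by (intro comp_add) auto
    finally show ?thesis by (simp only: prFx)
  qed
  show ?thesis
  proof
    assume "?G \<cdot> x = a"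
    then show "\<forall>j. pr j \<cdot> x = pr j \<cdot> a \<oplus> snd S j \<cdot> (pr (Suc j) \<cdot> x)" using prx by metis
  next
    assume R: "\<forall>j. pr j \<cdot> x = pr j \<cdot> a \<oplus> snd S j \<cdot> (pr (Suc j) \<cdot> x)"
    show "?G \<cdot> x = a"
    proof (rule is_product_eqI[OF P(1) _ xa(2)])
      show "?G \<cdot> x \<in> Hom A W P" using G xa' by (simp add: Hom_def)
      fix j
      have "snd S j \<cdot> (pr (Suc j) \<cdot> x) \<oplus> pr j \<cdot> (?G \<cdot> x) = pr j \<cdot> x"
        by (subst (2) prx) (use G pr f xa' in \<open>simp add: add_commute\<close>)
      also have "\<dots> = snd S j \<cdot> (pr (Suc j) \<cdot> x) \<oplus> pr j \<cdot> a"
        by (subst R[rule_format]) (use G pr f xa' in \<open>simp add: add_commute\<close>)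
      finally show "pr j \<cdot> (?G \<cdot> x) = pr j \<cdot> a"
        by (subst (asm) add_left_cancel) (use G pr f xa' in auto)
    qed
  qed
qed

text \<open>The right-hand side mentions neither \<open>P\<close> nor \<open>pr\<close> nor
  \<open>F\<close>. The criterion thus carries the mono property from one product of the sequence to
  another, as is required when the lim and lim1 in \<open>is_local\<close> come from different
  products.\<close>

lemma shift_difference_mono_iff:
  assumes S: "is_invseq A S" and sh: "is_shift A S P pr F"
  shows "is_mono A (hdiff A (ident A P) F) \<longleftrightarrow>
    (\<forall>W\<in>obj A. \<forall>x. (\<forall>j. x j \<in> Hom A W (fst S j) \<and> x j = snd S j \<cdot> x (Suc j)) \<longrightarrow>
      (\<forall>j. x j = hzero A W (fst S j)))" (is "_ \<longleftrightarrow> ?R")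
proof -
  let ?G = "hdiff A (ident A P) F"
  have P: "is_product A UNIV (fst S) P pr" "P \<in> obj A"
    using sh is_productD(1) by (auto simp: is_shift_def)
  have pr: "pr j \<in> arr A" "src A (pr j) = P" "tgt A (pr j) = fst S j" for j
    using is_productD(2)[OF P(1), of j] by (auto simp: Hom_def)
  have f: "snd S j \<in> arr A" "src A (snd S j) = fst S (Suc j)" "tgt A (snd S j) = fst S j"
    and So: "fst S j \<in> obj A" for j
    using S by (auto simp: is_invseq_def Hom_def)
  have G: "?G \<in> arr A" "src A ?G = P" "tgt A ?G = P"
    using shift_difference(1)[OF sh] by (auto simp: Hom_def)
  have prz: "pr j \<cdot> hzero A W P = hzero A W (fst S j)" if "W \<in> obj A" for j W
    using that pr P by simp
  have iff: "?G \<cdot> g = hzero A W P \<longleftrightarrow> (\<forall>j. pr j \<cdot> g = snd S j \<cdot> (pr (Suc j) \<cdot> g))"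
    if "g \<in> Hom A W P" for g W
  proof -
    have g: "g \<in> arr A" "src A g = W" "tgt A g = P" "W \<in> obj A"
      using that Hom_obj(1)[OF that] by (auto simp: Hom_def)
    have "hzero A W P \<in> Hom A W P" using g P by (simp add: Hom_def)
    then show ?thesis
      using shift_difference_eq_iff[OF S sh that, of "hzero A W P"] g f pr by (simp add: prz)
  qed
  show ?thesis
  proof
    assume mono: "is_mono A ?G"
    show ?R
    proof (intro ballI allI impI)
      fix W x j assume W: "W \<in> obj A" and x: "\<forall>j. x j \<in> Hom A W (fst S j) \<and> x j = snd S j \<cdot> x (Suc j)"
      obtain g where g: "g \<in> Hom A W P" "\<And>j. pr j \<cdot> g = x j"
        by (rule is_product_lift[OF P(1) W, of x]) (use x in blast)+
      have "?G \<cdot> g = hzero A W P" unfolding iff[OF g(1)] g(2) using x by blast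
      then have "g = hzero A W P" using mono g(1) G is_mono_iff[OF G(1)] by (auto simp: Hom_def)
      then show "x j = hzero A W (fst S j)" using g(2)[of j] prz[OF W] by simp
    qed
  next
    assume R: ?R
    show "is_mono A ?G"
    proof (subst is_mono_iff[OF G(1)], intro ballI impI)
      fix g assume g: "g \<in> arr A" "tgt A g = src A ?G" "?G \<cdot> g = hzero A (src A g) (tgt A ?G)"
      have g': "g \<in> Hom A (src A g) P" "src A g \<in> obj A" using g G src_obj by (auto simp: Hom_def)
      have "\<forall>j. pr j \<cdot> g = snd S j \<cdot> (pr (Suc j) \<cdot> g)"
        using iff[OF g'(1)] g(3) unfolding G(3) by blast
      moreover have "pr j \<cdot> g \<in> Hom A (src A g) (fst S j)" for j
        using g(1,2) G pr by (simp add: Hom_def)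
      ultimately have "pr j \<cdot> g = hzero A (src A g) (fst S j)" for j
        using R[rule_format, OF g'(2), of "\<lambda>j. pr j \<cdot> g"] by blast
      then have "g = hzero A (src A g) P"
        by (intro is_product_eqI[OF P(1) g'(1)]) (use g' P prz in \<open>auto simp: Hom_def\<close>)
      then show "g = hzero A (src A g) (src A ?G)" using G by simp
    qed
  qed
qed

lemma shift_exists:
  assumes S: "is_invseq A S" and P: "is_product A UNIV (fst S) P pr"
  obtains F where "is_shift A S P pr F"
proof -
  have "snd S j \<cdot> pr (Suc j) \<in> Hom A P (fst S j)" for j
    using comp_Hom[OF is_productD(2)[OF P, of "Suc j"], of "snd S j"] S by (auto simp: is_invseq_def)
  then obtain F where "F \<in> Hom A P P" "\<And>j. pr j \<cdot> F = snd S j \<cdot> pr (Suc j)"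
    using is_product_lift[OF P is_productD(1)[OF P], of "\<lambda>j. snd S j \<cdot> pr (Suc j)"] by auto
  then show ?thesis using P by (intro that[of F]) (simp add: is_shift_def)
qed

text \<open>Uniqueness for the zero family makes 1 - F mono. Solving the universal case, W =
  \<open>P\<close> with right-hand side \<open>pr\<close>, yields an arrow \<open>X\<close> with (1
  - F) X = 1, which makes 1 - F epi. A zero object then serves as both kernel and cokernel.\<close>

lemma local_if_uniquely_solvable:
  assumes S: "is_invseq A S" and P: "is_product A UNIV (fst S) P pr"
    and Z: "is_zero_object A Z" and sol: "uniquely_solvable A S"
  shows "is_local A S"
proof -
  obtain F where sh: "is_shift A S P pr F" using shift_exists[OF S P] .
  let ?G = "hdiff A (ident A P) F"
  have Po: "P \<in> obj A" using is_productD(1)[OF P] .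
  have pr: "pr j \<in> arr A" "src A (pr j) = P" "tgt A (pr j) = fst S j" for j
    using is_productD(2)[OF P, of j] by (auto simp: Hom_def)
  have f: "snd S j \<in> arr A" "src A (snd S j) = fst S (Suc j)" "tgt A (snd S j) = fst S j"
    and So: "fst S j \<in> obj A" for j
    using S by (auto simp: is_invseq_def Hom_def)
  have G: "?G \<in> arr A" "src A ?G = P" "tgt A ?G = P"
    using shift_difference(1)[OF sh] by (auto simp: Hom_def)
  have mono: "is_mono A ?G"
  proof (subst shift_difference_mono_iff[OF S sh], intro ballI allI impI)
    fix W x j assume W: "W \<in> obj A" and x: "\<forall>j. x j \<in> Hom A W (fst S j) \<and> x j = snd S j \<cdot> x (Suc j)"
    have x1: "x j \<in> Hom A W (fst S j)" for j using x by blast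
    have x2: "snd S j \<cdot> x (Suc j) = x j" for j using x by metis
    have x': "x j \<in> arr A" "src A (x j) = W" "tgt A (x j) = fst S j" for j
      using x1[of j] by (auto simp: Hom_def)
    have "x = (\<lambda>j. hzero A W (fst S j))"
      by (rule uniquely_solvable_unique[OF sol W, of "\<lambda>j. hzero A W (fst S j)"])
        (use x1 x' W So f in \<open>simp_all add: Hom_def x2\<close>)
    then show "x j = hzero A W (fst S j)" by simp
  qed
  have epi: "is_epi A ?G"
  proof -
    obtain x where x: "\<And>j. x j \<in> Hom A P (fst S j)" "\<And>j. x j = pr j \<oplus> snd S j \<cdot> x (Suc j)"
      by (rule uniquely_solvable_obtain[OF sol Po, of pr]) (use is_productD(2)[OF P] in blast)+
    obtain X where X: "X \<in> Hom A P P" "\<And>j. pr j \<cdot> X = x j"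
      using is_product_lift[OF P Po x(1)] by auto
    have GX: "?G \<cdot> X = ident A P"
      by (subst shift_difference_eq_iff[OF S sh X(1) ident_Hom[OF Po]])
        (use x(2) pr in \<open>simp add: X(2) flip: x(2)\<close>)
    have X': "X \<in> arr A" "src A X = P" "tgt A X = P" using X by (auto simp: Hom_def)
    show ?thesis
    proof (subst is_epi_iff[OF G(1)], intro ballI impI)
      fix g assume g: "g \<in> arr A" "src A g = tgt A ?G" "g \<cdot> ?G = hzero A (src A ?G) (tgt A g)"
      have "g = (g \<cdot> ?G) \<cdot> X" using g(1,2) G X' GX by (simp add: comp_assoc_arr)
      also have "\<dots> = hzero A (tgt A ?G) (tgt A g)" unfolding g(3) using g(1) G X'
        by (simp add: tgt_obj)
      finally show "g = hzero A (tgt A ?G) (tgt A g)" .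
    qed
  qed
  have Zo: "Z \<in> obj A" using Z by (simp add: is_zero_object_def)
  have "is_lim A S Z" unfolding is_lim_def
    using sh zero_kernel_of_mono[OF Z mono] G Zo Po
    by (intro exI[of _ P] exI[of _ pr] exI[of _ F] exI[of _ "hzero A Z P"]) simp
  moreover have "is_lim1 A S Z" unfolding is_lim1_def
    using sh zero_cokernel_of_epi[OF Z epi] G Zo Po
    by (intro exI[of _ P] exI[of _ pr] exI[of _ F] exI[of _ "hzero A P Z"]) simp
  ultimately show ?thesis using S Z by (auto simp: is_local_def)
qed

end

text \<open>Vanishing of lim and lim1 makes 1 - F mono and epi, hence invertible in an abelian
  category. The solution for a family \<open>a\<close>, assembled into \<open>b\<close>, is the
  inverse applied to \<open>b\<close>.\<close>

lemma (in abelian_category) uniquely_solvable_if_local: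
  assumes "is_local A S"
  shows "uniquely_solvable A S"
proof -
  have S: "is_invseq A S" using assms by (simp add: is_local_def)
  obtain P pr F k where sh: "is_shift A S P pr F" and
      k: "is_kernel A (hdiff A (ident A P) F) k" "is_zero_object A (src A k)"
    using assms by (auto simp: is_local_def is_lim_def)
  obtain Q qr H c where sh': "is_shift A S Q qr H" and
      c: "is_cokernel A (hdiff A (ident A Q) H) c" "is_zero_object A (tgt A c)"
    using assms by (auto simp: is_local_def is_lim1_def)
  let ?G = "hdiff A (ident A Q) H"
  have "is_mono A (hdiff A (ident A P) F)" by (rule mono_if_zero_kernel[OF k(2,1)])
  then have "is_mono A ?G"
    unfolding shift_difference_mono_iff[OF S sh] shift_difference_mono_iff[OF S sh'] .
  moreover have "is_epi A ?G" by (rule epi_if_zero_cokernel[OF c(2,1)])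
  moreover have G: "?G \<in> arr A" "src A ?G = Q" "tgt A ?G = Q"
    using shift_difference(1)[OF sh'] by (auto simp: Hom_def)
  ultimately obtain r where r: "r \<in> Hom A Q Q" "?G \<cdot> r = ident A Q" "r \<cdot> ?G = ident A Q"
    using mono_epi_iso by metis
  have Q: "is_product A UNIV (fst S) Q qr" using sh' by (simp add: is_shift_def)
  have qr: "qr j \<in> arr A" "src A (qr j) = Q" "tgt A (qr j) = fst S j" for j
    using is_productD(2)[OF Q, of j] by (auto simp: Hom_def)
  have r': "r \<in> arr A" "src A r = Q" "tgt A r = Q" using r by (auto simp: Hom_def)
  show ?thesis unfolding uniquely_solvable_def
  proof (intro ballI allI impI)
    fix W a assume W: "W \<in> obj A" and a: "\<forall>j. a j \<in> Hom A W (fst S j)"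
    obtain b where b: "b \<in> Hom A W Q" "\<And>j. qr j \<cdot> b = a j"
      using is_product_lift[OF Q W, of a] a by auto
    have b': "b \<in> arr A" "src A b = W" "tgt A b = Q" using b by (auto simp: Hom_def)
    have rb: "r \<cdot> b \<in> Hom A W Q" using r' b' by (simp add: Hom_def)
    have "?G \<cdot> (r \<cdot> b) = b" using r r' b' G by (simp add: comp_assoc_arr[symmetric])
    then have sol: "qr j \<cdot> (r \<cdot> b) = a j \<oplus> snd S j \<cdot> (qr (Suc j) \<cdot> (r \<cdot> b))" for j
      using shift_difference_eq_iff[OF S sh' rb b(1)] b(2) by metis
    show "\<exists>!x. \<forall>j. x j \<in> Hom A W (fst S j) \<and> x j = a j \<oplus> snd S j \<cdot> x (Suc j)"
    proof (rule ex1I[of _ "\<lambda>j. qr j \<cdot> (r \<cdot> b)"])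
      show "\<forall>j. qr j \<cdot> (r \<cdot> b) \<in> Hom A W (fst S j) \<and>
          qr j \<cdot> (r \<cdot> b) = a j \<oplus> snd S j \<cdot> (qr (Suc j) \<cdot> (r \<cdot> b))"
        using sol comp_Hom[OF rb is_productD(2)[OF Q]] by blast
      fix x assume x: "\<forall>j. x j \<in> Hom A W (fst S j) \<and> x j = a j \<oplus> snd S j \<cdot> x (Suc j)"
      obtain y where y: "y \<in> Hom A W Q" "\<And>j. qr j \<cdot> y = x j"
        by (rule is_product_lift[OF Q W, of x]) (use x in blast)+
      have y': "y \<in> arr A" "src A y = W" "tgt A y = Q" using y by (auto simp: Hom_def)
      have "?G \<cdot> y = b" unfolding shift_difference_eq_iff[OF S sh' y(1) b(1)] y(2) b(2)
        using x by blast
      then have "r \<cdot> b = y"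
        using r(3) r' y' G comp_assoc_arr[of y ?G r] by simp
      then show "x = (\<lambda>j. qr j \<cdot> (r \<cdot> b))" using y(2) by auto
    qed
  qed
qed

section \<open>Reflective subcategories\<close>

lemma (in category) reflective_if_universal_arrows:
  assumes univ: "\<And>X. X \<in> obj C \<Longrightarrow> \<exists>L \<eta>. L \<in> obj C \<and> P L \<and> \<eta> \<in> Hom C X L \<and>
    (\<forall>Y\<in>obj C. P Y \<longrightarrow> (\<forall>g\<in>Hom C X Y. \<exists>!h. h \<in> Hom C L Y \<and> h \<cdot> \<eta> = g))"
  shows "reflective C P"
proof -
  let ?D = "full_subcategory C P"
  have D: "obj ?D = {X \<in> obj C. P X}" "src ?D = src C" "tgt ?D = tgt C" "ident ?D = ident C"
    "comp ?D = comp C" by (auto simp: full_subcategory_def)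
  have HomD: "Hom ?D X Y = Hom C X Y" if "X \<in> obj ?D" "Y \<in> obj ?D" for X Y
    using that by (auto simp: Hom_def full_subcategory_def)
  define universal where "universal X L \<eta> \<longleftrightarrow> L \<in> obj C \<and> P L \<and> \<eta> \<in> Hom C X L \<and>
    (\<forall>Y\<in>obj C. P Y \<longrightarrow> (\<forall>g\<in>Hom C X Y. \<exists>!h. h \<in> Hom C L Y \<and> h \<cdot> \<eta> = g))" for X L \<eta>
  have "\<forall>X\<in>obj C. \<exists>L \<eta>. universal X L \<eta>" using univ unfolding universal_def by blast
  then obtain Lo \<eta> where *: "\<And>X. X \<in> obj C \<Longrightarrow> universal X (Lo X) (\<eta> X)" by metis
  have L: "Lo X \<in> obj C" "P (Lo X)" "\<eta> X \<in> Hom C X (Lo X)" if "X \<in> obj C" for X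
    using *[OF that] by (auto simp: universal_def)
  have ex1: "\<exists>!h. h \<in> Hom C (Lo X) Y \<and> h \<cdot> \<eta> X = g"
    if "X \<in> obj C" "Y \<in> obj C" "P Y" "g \<in> Hom C X Y" for X Y g
    using *[OF that(1)] that(2-4) by (simp add: universal_def)
  have uniq: "h = k" if "X \<in> obj C" "Y \<in> obj C" "P Y" "h \<in> Hom C (Lo X) Y" "k \<in> Hom C (Lo X) Y"
      "h \<cdot> \<eta> X = k \<cdot> \<eta> X" for X Y h k
    using ex1[OF that(1-3) comp_Hom[OF L(3)[OF that(1)] that(5)]] that(4-6) by blast
  \<comment> \<open>The value on arrows is forced by naturality of the unit \<eta>, so both functor
    laws become instances of \<open>uniq\<close>.\<close>
  define La where "La u = (THE h. h \<in> Hom C (Lo (src C u)) (Lo (tgt C u)) \<and>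
    h \<cdot> \<eta> (src C u) = \<eta> (tgt C u) \<cdot> u)" for u
  have La: "La u \<in> Hom C (Lo X) (Lo Y) \<and> La u \<cdot> \<eta> X = \<eta> Y \<cdot> u" if u: "u \<in> Hom C X Y" for u X Y
  proof -
    have XY: "src C u = X" "tgt C u = Y" using u by (auto simp: Hom_def)
    show ?thesis unfolding La_def XY
      by (rule theI', rule ex1[OF Hom_obj(1)[OF u] L(1,2)])
        (use Hom_obj[OF u] comp_Hom[OF u L(3)] in auto)
  qed
  have F1: "is_functor C ?D Lo La"
    unfolding is_functor_def
  proof (intro conjI ballI)
    show LoD: "Lo X \<in> obj ?D" if "X \<in> obj C" for X using L that by (simp add: D)
    show "La f \<in> Hom ?D (Lo X) (Lo Y)" if "X \<in> obj C" "Y \<in> obj C" "f \<in> Hom C X Y" for X Y f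
      using La[OF that(3)] HomD[OF LoD LoD] that by simp
    show "La (ident C X) = ident ?D (Lo X)" if X: "X \<in> obj C" for X
    proof -
      have eta: "\<eta> X \<in> arr C" "src C (\<eta> X) = X" "tgt C (\<eta> X) = Lo X"
        using L(3)[OF X] by (auto simp: Hom_def)
      have "La (ident C X) = ident C (Lo X)"
        by (rule uniq[OF X L(1,2)[OF X]]) (use X La[OF ident_Hom[OF X]] L eta in \<open>auto simp: ident_Hom\<close>)
      then show ?thesis by (simp add: D)
    qed
    show "La (g \<cdot> f) = La g \<cdot>\<^bsub>?D\<^esub> La f"
      if o: "X \<in> obj C" "Y \<in> obj C" "Z \<in> obj C" and f: "f \<in> Hom C X Y" and g: "g \<in> Hom C Y Z"
      for X Y Z f g
    proof -
      note Laf = La[OF f, THEN conjunct1] La[OF f, THEN conjunct2]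
        and Lag = La[OF g, THEN conjunct1] La[OF g, THEN conjunct2]
        and Lagf = La[OF comp_Hom[OF f g], THEN conjunct1] La[OF comp_Hom[OF f g], THEN conjunct2]
      have "(La g \<cdot> La f) \<cdot> \<eta> X = La g \<cdot> (\<eta> Y \<cdot> f)"
        using comp_assoc[OF L(3)[OF o(1)] Laf(1) Lag(1)] Laf(2) by simp
      also have "\<dots> = (\<eta> Z \<cdot> g) \<cdot> f"
        using comp_assoc[OF f L(3)[OF o(2)] Lag(1)] Lag(2) by simp
      also have "\<dots> = La (g \<cdot> f) \<cdot> \<eta> X"
        using comp_assoc[OF f g L(3)[OF o(3)]] Lagf(2) by simp
      finally have "La (g \<cdot> f) = La g \<cdot> La f"
        by (intro uniq[OF o(1) L(1,2)[OF o(3)] Lagf(1) comp_Hom[OF Laf(1) Lag(1)]]) simp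
      then show ?thesis by (simp add: D)
    qed
  qed
  have F2: "is_functor ?D C (\<lambda>X. X) (\<lambda>f. f)"
    unfolding is_functor_def by (auto simp: D HomD)
  \<comment> \<open>The bijection of hom-sets is precomposition with the unit.\<close>
  have adj: "is_adjunction C ?D Lo La (\<lambda>X. X) (\<lambda>f. f)"
    unfolding is_adjunction_def
  proof (intro conjI F1 F2 exI[of _ "\<lambda>X Y h. h \<cdot> \<eta> X"] ballI)
    fix X Y assume X: "X \<in> obj C" and Y: "Y \<in> obj ?D"
    have Y': "Y \<in> obj C" "P Y" using Y by (auto simp: D)
    have H: "Hom ?D (Lo X) Y = Hom C (Lo X) Y"
      using HomD[OF _ Y, of "Lo X"] L[OF X] by (simp add: D)
    show "bij_betw (\<lambda>h. h \<cdot> \<eta> X) (Hom ?D (Lo X) Y) (Hom C X Y)"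
      unfolding H bij_betw_def
    proof (intro conjI inj_onI equalityI subsetI)
      show "h = k" if "h \<in> Hom C (Lo X) Y" "k \<in> Hom C (Lo X) Y" "h \<cdot> \<eta> X = k \<cdot> \<eta> X" for h k
        by (rule uniq[OF X Y' that])
      show "g \<in> Hom C X Y" if "g \<in> (\<lambda>h. h \<cdot> \<eta> X) ` Hom C (Lo X) Y" for g
        using that comp_Hom[OF L(3)[OF X]] by auto
      show "g \<in> (\<lambda>h. h \<cdot> \<eta> X) ` Hom C (Lo X) Y" if "g \<in> Hom C X Y" for g
        using ex1[OF X Y' that] by blast
    qed
  next
    fix X X' Y Y' u v h
    assume X: "X \<in> obj C" "X' \<in> obj C" and Y: "Y \<in> obj ?D" "Y' \<in> obj ?D"
      and u: "u \<in> Hom C X' X" and v: "v \<in> Hom ?D Y Y'" and h: "h \<in> Hom ?D (Lo X) Y"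
    have LX: "Lo X \<in> obj ?D" using L[OF X(1)] by (simp add: D)
    have v': "v \<in> Hom C Y Y'" and h': "h \<in> Hom C (Lo X) Y" using v h Y LX by (auto simp: HomD)
    note Lau = La[OF u, THEN conjunct1] La[OF u, THEN conjunct2]
    note eta = L(3)[OF X(1)] and eta' = L(3)[OF X(2)]
    have "(v \<cdot> h \<cdot> La u) \<cdot> \<eta> X' = v \<cdot> (h \<cdot> (La u \<cdot> \<eta> X'))"
      using comp_assoc[OF eta' comp_Hom[OF Lau(1) h'] v'] comp_assoc[OF eta' Lau(1) h'] by simp
    also have "\<dots> = v \<cdot> (h \<cdot> \<eta> X) \<cdot> u"
      using comp_assoc[OF u eta h'] Lau(2) by simp
    finally show "(v \<cdot>\<^bsub>?D\<^esub> h \<cdot>\<^bsub>?D\<^esub> La u) \<cdot> \<eta> X' = v \<cdot> (h \<cdot> \<eta> X) \<cdot> u" by (simp add: D)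
  qed
  show ?thesis unfolding reflective_def using adj by blast
qed

section \<open>The category of inverse sequences\<close>

lemma invseq_Hom_iff:
  "m \<in> Hom (invseq_cat C) S T \<longleftrightarrow> (\<exists>\<phi>. m = (S, T, \<phi>) \<and> is_invseq C S \<and> is_invseq C T \<and>
    (\<forall>i. \<phi> i \<in> Hom C (fst S i) (fst T i)) \<and>
    (\<forall>i. snd T i \<cdot>\<^bsub>C\<^esub> \<phi> (Suc i) = \<phi> i \<cdot>\<^bsub>C\<^esub> snd S i))"
  by (auto simp: Hom_def invseq_cat_def)

lemma invseq_comp: "(T', U, \<psi>) \<cdot>\<^bsub>invseq_cat C\<^esub> (S, T, \<phi>) = (S, U, \<lambda>i. \<psi> i \<cdot>\<^bsub>C\<^esub> \<phi> i)"
  by (simp add: invseq_cat_def)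

lemma invseq_obj: "obj (invseq_cat C) = {S. is_invseq C S}"
  by (simp add: invseq_cat_def)

lemma (in category) invseq_category: "category (invseq_cat C)"
proof
  fix f assume "f \<in> arr (invseq_cat C)"
  then show "src (invseq_cat C) f \<in> obj (invseq_cat C)" "tgt (invseq_cat C) f \<in> obj (invseq_cat C)"
    by (auto simp: invseq_cat_def)
next
  fix X assume X: "X \<in> obj (invseq_cat C)"
  have f: "fst X i \<in> obj C" "snd X i \<in> Hom C (fst X (Suc i)) (fst X i)" for i
    using X by (auto simp: invseq_obj is_invseq_def)
  show "ident (invseq_cat C) X \<in> Hom (invseq_cat C) X X"
    unfolding invseq_Hom_iff
    using X ident_Hom[OF f(1)] comp_ident[OF f(2)] ident_comp[OF f(2)]
    by (simp add: invseq_cat_def)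
next
  fix f X Y g Z assume f: "f \<in> Hom (invseq_cat C) X Y" and g: "g \<in> Hom (invseq_cat C) Y Z"
  obtain \<phi> where \<phi>: "f = (X, Y, \<phi>)" "is_invseq C X" "\<And>i. \<phi> i \<in> Hom C (fst X i) (fst Y i)"
    "\<And>i. snd Y i \<cdot> \<phi> (Suc i) = \<phi> i \<cdot> snd X i" using f unfolding invseq_Hom_iff by blast
  obtain \<psi> where \<psi>: "g = (Y, Z, \<psi>)" "is_invseq C Y" "is_invseq C Z"
    "\<And>i. \<psi> i \<in> Hom C (fst Y i) (fst Z i)"
    "\<And>i. snd Z i \<cdot> \<psi> (Suc i) = \<psi> i \<cdot> snd Y i" using g unfolding invseq_Hom_iff by blast
  have s: "snd X i \<in> Hom C (fst X (Suc i)) (fst X i)" "snd Y i \<in> Hom C (fst Y (Suc i)) (fst Y i)"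
    "snd Z i \<in> Hom C (fst Z (Suc i)) (fst Z i)" for i
    using \<phi>(2) \<psi>(2,3) by (auto simp: is_invseq_def)
  have "snd Z i \<cdot> (\<psi> (Suc i) \<cdot> \<phi> (Suc i)) = (\<psi> i \<cdot> \<phi> i) \<cdot> snd X i" for i
    using comp_assoc[OF \<phi>(3) \<psi>(4) s(3), of i] comp_assoc[OF \<phi>(3) s(2) \<psi>(4), of i]
      comp_assoc[OF s(1) \<phi>(3) \<psi>(4), of i] \<phi>(4)[of i] \<psi>(5)[of i] by simp
  then show "g \<cdot>\<^bsub>invseq_cat C\<^esub> f \<in> Hom (invseq_cat C) X Z"
    unfolding invseq_Hom_iff using \<phi>(1,2) \<psi>(1,3) comp_Hom[OF \<phi>(3) \<psi>(4)]
    by (simp add: invseq_comp)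
next
  fix f X Y assume "f \<in> Hom (invseq_cat C) X Y"
  then obtain \<phi> where \<phi>: "f = (X, Y, \<phi>)" "\<And>i. \<phi> i \<in> Hom C (fst X i) (fst Y i)"
    unfolding invseq_Hom_iff by blast
  show "f \<cdot>\<^bsub>invseq_cat C\<^esub> ident (invseq_cat C) X = f" "ident (invseq_cat C) Y \<cdot>\<^bsub>invseq_cat C\<^esub> f = f"
    using comp_ident[OF \<phi>(2)] ident_comp[OF \<phi>(2)] \<phi>(1) by (auto simp: invseq_cat_def)
next
  fix f W X g Y h Z assume "f \<in> Hom (invseq_cat C) W X" "g \<in> Hom (invseq_cat C) X Y"
    "h \<in> Hom (invseq_cat C) Y Z"
  then obtain \<phi> \<psi> \<chi> where \<phi>: "f = (W, X, \<phi>)" "\<And>i. \<phi> i \<in> Hom C (fst W i) (fst X i)"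
    and \<psi>: "g = (X, Y, \<psi>)" "\<And>i. \<psi> i \<in> Hom C (fst X i) (fst Y i)"
    and \<chi>: "h = (Y, Z, \<chi>)" "\<And>i. \<chi> i \<in> Hom C (fst Y i) (fst Z i)"
    unfolding invseq_Hom_iff by blast
  show "(h \<cdot>\<^bsub>invseq_cat C\<^esub> g) \<cdot>\<^bsub>invseq_cat C\<^esub> f = h \<cdot>\<^bsub>invseq_cat C\<^esub> (g \<cdot>\<^bsub>invseq_cat C\<^esub> f)"
    using comp_assoc[OF \<phi>(2) \<psi>(2) \<chi>(2)] by (simp add: \<phi>(1) \<psi>(1) \<chi>(1) invseq_comp)
qed

section \<open>The localization of an inverse sequence\<close>

text \<open>This is the vanishing of lim1 on a constant sequence: \<open>z j\<close> is minus the
  sum of the earlier terms \<open>a 0\<close>, ..., \<open>a (j - 1)\<close>. The start value zero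
  is one choice among many, as adding a fixed arrow to all \<open>z j\<close> gives another
  solution; \<open>N_solvable\<close> exploits this freedom.\<close>

lemma (in preadditive_category) telescope_exists:
  assumes a: "\<And>j. a j \<in> Hom A W X"
  obtains z where "\<And>j :: nat. z j \<in> Hom A W X" "\<And>j. a j \<oplus> z (Suc j) = z j"
proof -
  define z where "z = rec_nat (hzero A W X) (\<lambda>j y. y \<oplus> neg (a j))"
  have a': "a j \<in> arr A" "src A (a j) = W" "tgt A (a j) = X" for j using a by (auto simp: Hom_def)
  have WX: "W \<in> obj A" "X \<in> obj A" using Hom_obj[OF a] by auto
  have z: "z j \<in> arr A \<and> src A (z j) = W \<and> tgt A (z j) = X" for j
    by (induction j) (use a' WX in \<open>auto simp: z_def\<close>)
  have "z (Suc j) = z j \<oplus> neg (a j)" for j by (simp add: z_def)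
  then have "a j \<oplus> z (Suc j) = z j" for j
    using z[of j] a' by (simp add: add_left_commute[of "a j" "z j"])
  then show ?thesis using z by (intro that[of z]) (auto simp: Hom_def)
qed

text \<open>
  Here \<open>\<Delta>\<close> is \<open>1 - F\<close> for the shift \<open>F\<close> of \<open>P = \<Prod>\<^sub>i S i\<close>, and \<open>N j = P \<oplus> S j\<close> with projections
  \<open>\<pi> j\<close>, \<open>\<rho> j\<close>.
\<close>

locale localization_data = abelian_category A
  for A :: "('o, 'm, 'x) preadd_cat_scheme" (structure) +
  fixes S :: "nat \<Rightarrow> 'o" and f :: "nat \<Rightarrow> 'm" and P :: 'o and pr :: "nat \<Rightarrow> 'm" and \<Delta> :: 'm
    and N :: "nat \<Rightarrow> 'o" and \<pi> \<rho> d t q :: "nat \<Rightarrow> 'm"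
  assumes f_Hom: "f j \<in> Hom A (S (Suc j)) (S j)"
    and P_prod: "is_product A UNIV S P pr"
    and \<Delta>_Hom: "\<Delta> \<in> Hom A P P"
    and pr_\<Delta>: "pr j \<cdot> \<Delta> \<oplus> f j \<cdot> pr (Suc j) = pr j"
    and N_prod: "is_product A UNIV (\<lambda>b. if b then P else S j) (N j) (\<lambda>b. if b then \<pi> j else \<rho> j)"
    and d_Hom: "d j \<in> Hom A P (N j)" and \<pi>_d: "\<pi> j \<cdot> d j = \<Delta>" and \<rho>_d: "\<rho> j \<cdot> d j = pr j"
    and t_Hom: "t j \<in> Hom A (N (Suc j)) (N j)" and \<pi>_t: "\<pi> j \<cdot> t j = \<pi> (Suc j)"
    and \<rho>_t: "\<rho> j \<cdot> t j = f j \<cdot> \<rho> (Suc j) \<oplus> pr j \<cdot> \<pi> (Suc j)"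
    and q_coker: "is_cokernel A (d j) (q j)"
begin

lemma f_simps [simp]: "f j \<in> arr A" "src A (f j) = S (Suc j)" "tgt A (f j) = S j"
  using f_Hom by (auto simp: Hom_def)

lemma P_obj [simp]: "P \<in> obj A"
  using is_productD(1)[OF P_prod] .

lemma pr_simps [simp]: "pr j \<in> arr A" "src A (pr j) = P" "tgt A (pr j) = S j"
  using is_productD(2)[OF P_prod, of j] by (auto simp: Hom_def)

lemma S_obj [simp]: "S j \<in> obj A"
  using tgt_obj[of "pr j"] by simp

lemma \<Delta>_simps [simp]: "\<Delta> \<in> arr A" "src A \<Delta> = P" "tgt A \<Delta> = P"
  using \<Delta>_Hom by (auto simp: Hom_def)

lemma N_obj [simp]: "N j \<in> obj A"
  using is_productD(1)[OF N_prod] .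

lemma \<pi>_simps [simp]: "\<pi> j \<in> arr A" "src A (\<pi> j) = N j" "tgt A (\<pi> j) = P"
  using is_productD(2)[OF N_prod, of True j] by (auto simp: Hom_def)

lemma \<rho>_simps [simp]: "\<rho> j \<in> arr A" "src A (\<rho> j) = N j" "tgt A (\<rho> j) = S j"
  using is_productD(2)[OF N_prod, of False j] by (auto simp: Hom_def)

lemma d_simps [simp]: "d j \<in> arr A" "src A (d j) = P" "tgt A (d j) = N j"
  using d_Hom by (auto simp: Hom_def)

lemma t_simps [simp]: "t j \<in> arr A" "src A (t j) = N (Suc j)" "tgt A (t j) = N j"
  using t_Hom by (auto simp: Hom_def)

lemma q_simps [simp]: "q j \<in> arr A" "src A (q j) = N j" "tgt A (q j) \<in> obj A"
  using is_cokernelD[OF q_coker] tgt_obj by auto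

lemma q_d: "q j \<cdot> d j = hzero A P (tgt A (q j))"
  using is_cokernelD(4)[OF q_coker] by simp

lemma N_eqI:
  assumes "x \<in> Hom A W (N j)" "y \<in> Hom A W (N j)" "\<pi> j \<cdot> x = \<pi> j \<cdot> y" "\<rho> j \<cdot> x = \<rho> j \<cdot> y"
  shows "x = y"
  by (rule is_product_eqI[OF N_prod assms(1,2)]) (use assms(3,4) in auto)

lemma N_pair:
  assumes "y \<in> Hom A W P" "s \<in> Hom A W (S j)"
  obtains x where "x \<in> Hom A W (N j)" "\<pi> j \<cdot> x = y" "\<rho> j \<cdot> x = s"
proof -
  have "W \<in> obj A" using Hom_obj(1)[OF assms(1)] .
  then obtain x where "x \<in> Hom A W (N j)"
      "\<And>b. (if b then \<pi> j else \<rho> j) \<cdot> x = (if b then y else s)"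
    by (rule is_product_lift[OF N_prod, of _ "\<lambda>b. if b then y else s"]) (use assms in auto)
  from this(1) this(2)[of True] this(2)[of False] show ?thesis by (intro that) auto
qed

section \<open>Linear equations over the sequence N\<close>

lemma t_components:
  assumes "x \<in> arr A" "tgt A x = N (Suc j)"
  shows "\<pi> j \<cdot> (t j \<cdot> x) = \<pi> (Suc j) \<cdot> x"
    and "\<rho> j \<cdot> (t j \<cdot> x) = f j \<cdot> (\<rho> (Suc j) \<cdot> x) \<oplus> pr j \<cdot> (\<pi> (Suc j) \<cdot> x)"
  using assms comp_assoc_arr[of x "t j" "\<pi> j"] comp_assoc_arr[of x "t j" "\<rho> j"]
  by (simp_all add: \<pi>_t \<rho>_t add_comp comp_assoc_arr)

lemma d_components:
  assumes "x \<in> arr A" "tgt A x = P"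
  shows "\<pi> j \<cdot> (d j \<cdot> x) = \<Delta> \<cdot> x" and "\<rho> j \<cdot> (d j \<cdot> x) = pr j \<cdot> x"
  using assms comp_assoc_arr[of x "d j" "\<pi> j"] comp_assoc_arr[of x "d j" "\<rho> j"]
  by (simp_all add: \<pi>_d \<rho>_d)

lemma pr_\<Delta>_comp:
  assumes "x \<in> arr A" "tgt A x = P"
  shows "pr j \<cdot> (\<Delta> \<cdot> x) \<oplus> f j \<cdot> (pr (Suc j) \<cdot> x) = pr j \<cdot> x"
  using assms by (subst (3) pr_\<Delta>[symmetric]) (simp add: add_comp comp_assoc_arr)

text \<open>This makes \<open>d\<close> a morphism from the constant sequence \<open>P\<close> to N.
  In the second component the extra summand of \<open>\<rho>_t\<close> contributes pr j \<Delta>,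
  exactly what f j pr (j+1) lacks to be \<open>pr j\<close>.\<close>

lemma t_d: "t j \<cdot> d (Suc j) = d j"
  by (rule N_eqI[of _ P j])
    (simp_all add: Hom_def t_components \<pi>_d \<rho>_d add_commute[of "f j \<cdot> pr (Suc j)"] pr_\<Delta>)

text \<open>The level-wise maps \<open>d j\<close> identify \<open>Hom A W P\<close> with the maps from \<open>W\<close> to the limit of \<open>N\<close>.\<close>

lemma N_homogeneous:
  assumes e: "\<And>j. e j \<in> Hom A W (N j)" "\<And>j. t j \<cdot> e (Suc j) = e j"
  obtains w where "w \<in> Hom A W P" "\<And>j. d j \<cdot> w = e j"
proof -
  have e': "e j \<in> arr A" "src A (e j) = W" "tgt A (e j) = N j" for j
    using e(1)[of j] by (auto simp: Hom_def)
  have W: "W \<in> obj A" using Hom_obj(1)[OF e(1)[of 0]] .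
  define y where "y = \<pi> 0 \<cdot> e 0"
  have y: "y \<in> arr A" "src A y = W" "tgt A y = P" using e' by (auto simp: y_def)
  have "\<pi> (Suc j) \<cdot> e (Suc j) = \<pi> j \<cdot> e j" for j
    using t_components(1)[of "e (Suc j)" j] e' e(2)[of j] by simp
  then have \<pi>e: "\<pi> j \<cdot> e j = y" for j by (induction j) (auto simp: y_def)
  obtain w where w: "w \<in> Hom A W P" "\<And>j. pr j \<cdot> w = \<rho> j \<cdot> e j"
    using is_product_lift[OF P_prod W, of "\<lambda>j. \<rho> j \<cdot> e j"] e' by (auto simp: Hom_def)
  have w': "w \<in> arr A" "src A w = W" "tgt A w = P" using w by (auto simp: Hom_def)
  \<comment> \<open>The second components of the homogeneous equations say pr j w = f j (pr (j+1) w)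
    + pr j y. By \<open>pr_\<Delta>_comp\<close> the same holds with \<Delta> w in place of y, so
    the two agree after each projection.\<close>
  have "\<Delta> \<cdot> w = y"
  proof (rule is_product_eqI[OF P_prod])
    show "\<Delta> \<cdot> w \<in> Hom A W P" "y \<in> Hom A W P" using w' y by (auto simp: Hom_def)
    fix j
    have "f j \<cdot> (pr (Suc j) \<cdot> w) \<oplus> pr j \<cdot> (\<Delta> \<cdot> w) = pr j \<cdot> w"
      using pr_\<Delta>_comp[of w j] w' by (simp add: add_commute)
    also have "\<dots> = f j \<cdot> (pr (Suc j) \<cdot> w) \<oplus> pr j \<cdot> y"
      using t_components(2)[of "e (Suc j)" j] e' e(2)[of j] by (simp add: \<pi>e w(2))
    finally show "pr j \<cdot> (\<Delta> \<cdot> w) = pr j \<cdot> y"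
      by (subst (asm) add_left_cancel) (use w' y in auto)
  qed
  with w' e' have "d j \<cdot> w = e j" for j
    using N_eqI[of "d j \<cdot> w" W j "e j"] by (simp add: Hom_def d_components w(2) \<pi>e)
  with w(1) show ?thesis by (rule that)
qed

text \<open>The difference of two solutions solves the homogeneous system, so by
  \<open>N_homogeneous\<close> it has the form d j w, which \<open>q j\<close> kills.\<close>

lemma N_unique_modulo_d:
  assumes a: "\<And>j. a j \<in> Hom A W (N j)"
    and x: "\<And>j. x j \<in> Hom A W (N j)" "\<And>j. x j = a j \<oplus> t j \<cdot> x (Suc j)"
    and y: "\<And>j. y j \<in> Hom A W (N j)" "\<And>j. y j = a j \<oplus> t j \<cdot> y (Suc j)"
  shows "q j \<cdot> x j = q j \<cdot> y j"
proof -
  have a': "a j \<in> arr A" "src A (a j) = W" "tgt A (a j) = N j"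
    and x': "x j \<in> arr A" "src A (x j) = W" "tgt A (x j) = N j"
    and y': "y j \<in> arr A" "src A (y j) = W" "tgt A (y j) = N j" for j
    using a[of j] x(1)[of j] y(1)[of j] by (auto simp: Hom_def)
  define e where "e j = x j \<oplus> neg (y j)" for j
  have e: "e j \<in> arr A" "src A (e j) = W" "tgt A (e j) = N j" for j
    using x' y' by (simp_all add: e_def)
  have ye: "y j \<oplus> e j = x j" for j
    using x'[of j] y'[of j] by (simp add: e_def add_left_commute[of "y j" "x j"])
  have "y j \<oplus> t j \<cdot> e (Suc j) = y j \<oplus> e j" for j
  proof -
    have "y j \<oplus> t j \<cdot> e (Suc j) = a j \<oplus> (t j \<cdot> y (Suc j) \<oplus> t j \<cdot> e (Suc j))"
      using a' y' e by (subst y(2)) (simp add: add_assoc)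
    also have "\<dots> = a j \<oplus> t j \<cdot> x (Suc j)"
      using y' e by (simp add: comp_add[symmetric] ye)
    finally show ?thesis using x(2)[of j] ye[of j] by simp
  qed
  then have "t j \<cdot> e (Suc j) = e j" for j
    by (subst (asm) add_left_cancel) (use y' e in auto)
  then obtain w where w: "w \<in> Hom A W P" "\<And>j. d j \<cdot> w = e j"
    using N_homogeneous[of e W] e by (auto simp: Hom_def)
  have w': "w \<in> arr A" "src A w = W" "tgt A w = P" "W \<in> obj A"
    using w(1) Hom_obj(1)[OF w(1)] by (auto simp: Hom_def)
  have "q j \<cdot> e j = hzero A W (tgt A (q j))"
    unfolding w(2)[symmetric] using w' by (simp add: comp_assoc_arr[symmetric] q_d)
  then show ?thesis
    using ye[of j, symmetric] y'[of j] e[of j] by (simp add: comp_add)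
qed

text \<open>This is the vanishing of lim1 on N. The equations for the first components telescope and
  leave a constant \<open>c\<close> free. With all second components set to zero, the remaining
  equations read 0 = \<rho> j a j + pr j (c + z (j+1)). They prescribe every projection of
  \<open>c\<close>, and the product property of \<open>P\<close> provides such an arrow.\<close>

lemma N_solvable:
  assumes a: "\<And>j. a j \<in> Hom A W (N j)"
  obtains x where "\<And>j. x j \<in> Hom A W (N j)" "\<And>j. x j = a j \<oplus> t j \<cdot> x (Suc j)"
proof -
  have a': "a j \<in> arr A" "src A (a j) = W" "tgt A (a j) = N j" for j
    using a[of j] by (auto simp: Hom_def)
  have W: "W \<in> obj A" using Hom_obj(1)[OF a[of 0]] .
  obtain z where z: "\<And>j. z j \<in> Hom A W P" "\<And>j. \<pi> j \<cdot> a j \<oplus> z (Suc j) = z j"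
    by (rule telescope_exists[of "\<lambda>j. \<pi> j \<cdot> a j" W P]) (use a' in \<open>auto simp: Hom_def\<close>)
  have z': "z j \<in> arr A" "src A (z j) = W" "tgt A (z j) = P" for j
    using z(1)[of j] by (auto simp: Hom_def)
  obtain c where c: "c \<in> Hom A W P" "\<And>j. pr j \<cdot> c = neg (\<rho> j \<cdot> a j \<oplus> pr j \<cdot> z (Suc j))"
    using is_product_lift[OF P_prod W, of "\<lambda>j. neg (\<rho> j \<cdot> a j \<oplus> pr j \<cdot> z (Suc j))"] a' z'
    by (auto simp: Hom_def)
  have c': "c \<in> arr A" "src A c = W" "tgt A c = P" using c by (auto simp: Hom_def)
  have "\<exists>x. x \<in> Hom A W (N j) \<and> \<pi> j \<cdot> x = c \<oplus> z j \<and> \<rho> j \<cdot> x = hzero A W (S j)" for j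
    by (rule N_pair[of "c \<oplus> z j" W "hzero A W (S j)" j]) (use c' z' W in \<open>auto simp: Hom_def\<close>)
  then obtain x where x: "\<And>j. x j \<in> Hom A W (N j)" "\<And>j. \<pi> j \<cdot> x j = c \<oplus> z j"
    "\<And>j. \<rho> j \<cdot> x j = hzero A W (S j)" by metis
  have x': "x j \<in> arr A" "src A (x j) = W" "tgt A (x j) = N j" for j
    using x(1)[of j] by (auto simp: Hom_def)
  have "x j = a j \<oplus> t j \<cdot> x (Suc j)" for j
  proof (rule N_eqI[OF x(1)])
    show "a j \<oplus> t j \<cdot> x (Suc j) \<in> Hom A W (N j)" using a' x' by (simp add: Hom_def)
    have "\<pi> j \<cdot> (a j \<oplus> t j \<cdot> x (Suc j)) = \<pi> j \<cdot> a j \<oplus> (c \<oplus> z (Suc j))"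
      using a' x' by (simp add: comp_add t_components x)
    also have "\<dots> = c \<oplus> z j"
      using a' z' c' by (simp add: add_left_commute[of _ c] z(2))
    finally show "\<pi> j \<cdot> x j = \<pi> j \<cdot> (a j \<oplus> t j \<cdot> x (Suc j))" using x(2) by simp
    let ?s = "\<rho> j \<cdot> a j" and ?p = "pr j \<cdot> z (Suc j)"
    have "\<rho> j \<cdot> (a j \<oplus> t j \<cdot> x (Suc j)) = ?s \<oplus> pr j \<cdot> (c \<oplus> z (Suc j))"
      using a' x' W c' z' by (simp add: comp_add t_components x)
    also have "\<dots> = ?s \<oplus> (neg (?s \<oplus> ?p) \<oplus> ?p)"
      using c' z' by (simp add: comp_add c(2))
    also have "\<dots> = neg (?s \<oplus> ?p) \<oplus> (?s \<oplus> ?p)"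
      using a' z' by (intro add_left_commute) auto
    also have "\<dots> = hzero A W (S j)" using a' z' by simp
    finally show "\<rho> j \<cdot> x j = \<rho> j \<cdot> (a j \<oplus> t j \<cdot> x (Suc j))" using x(3) by simp
  qed
  with x(1) show ?thesis by (rule that)
qed

lemma transition_exists:
  obtains l where "\<And>j. l j \<in> Hom A (tgt A (q (Suc j))) (tgt A (q j))"
    "\<And>j. l j \<cdot> q (Suc j) = q j \<cdot> t j"
proof -
  have "\<exists>u. u \<in> Hom A (tgt A (q (Suc j))) (tgt A (q j)) \<and> u \<cdot> q (Suc j) = q j \<cdot> t j" for j
  proof (rule is_cokernel_lift[OF q_coker[of "Suc j"], of "q j \<cdot> t j"])
    show "(q j \<cdot> t j) \<cdot> d (Suc j) = hzero A (src A (d (Suc j))) (tgt A (q j \<cdot> t j))"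
      by (simp add: comp_assoc_arr t_d q_d)
  qed (auto simp: Hom_def)
  then show ?thesis using that by metis
qed

end

section \<open>The cokernel sequence and its locality\<close>

locale localization = localization_data A S f P pr \<Delta> N \<pi> \<rho> d t q
  for A :: "('o, 'm, 'x) preadd_cat_scheme" (structure) and S f P pr \<Delta> N \<pi> \<rho> d t q +
  fixes l :: "nat \<Rightarrow> 'm"
  assumes l_Hom: "l j \<in> Hom A (tgt A (q (Suc j))) (tgt A (q j))"
    and l_q: "l j \<cdot> q (Suc j) = q j \<cdot> t j"
begin

abbreviation L :: "('o, 'm) invseq"
  where "L \<equiv> (\<lambda>j. tgt A (q j), l)"

lemma l_simps [simp]: "l j \<in> arr A" "src A (l j) = tgt A (q (Suc j))" "tgt A (l j) = tgt A (q j)"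
  using l_Hom by (auto simp: Hom_def)

lemma invseq_L: "is_invseq A L"
  using l_Hom by (simp add: is_invseq_def)

lemma q_epi: "is_epi A (q j)"
  by (rule cokernel_epi[OF q_coker])

lemma l_q_comp: "x \<in> arr A \<Longrightarrow> tgt A x = N (Suc j) \<Longrightarrow> l j \<cdot> (q (Suc j) \<cdot> x) = q j \<cdot> (t j \<cdot> x)"
  using comp_assoc_arr[of x "q (Suc j)" "l j"] comp_assoc_arr[of x "t j" "q j"] by (simp add: l_q)

text \<open>
  The section \<open>x\<close> of \<open>1 - FN\<close> descends along the cokernel \<open>E\<close> of products to \<open>v\<close>, a two-sided inverse
  of \<open>1 - FL\<close>: it descends because \<open>x\<close> is unique up to the image of \<open>d\<close>, and \<open>1 - F\<close> is split epi on
  the constant sequence \<open>P\<close> (the telescope \<open>y\<close>).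
\<close>

lemma L_uniquely_solvable:
  fixes \<Lambda> :: "'u rel"
  assumes \<Lambda>: "inaccessible_cardinal \<Lambda>" and ex: "has_exact_small_products \<Lambda> A"
  shows "uniquely_solvable A L"
proof -
  have prods: "has_small_products \<Lambda> A" using ex by (simp add: has_exact_small_products_def)
  obtain PP p where PP: "is_product A UNIV (\<lambda>j :: nat. P) PP p"
    using countable_product_exists[OF \<Lambda> prods, of "\<lambda>j. P"] by auto
  obtain NN n where NN: "is_product A UNIV N NN n"
    using countable_product_exists[OF \<Lambda> prods, of N] by auto
  obtain LL s where LL: "is_product A UNIV (\<lambda>j. tgt A (q j)) LL s"
    using countable_product_exists[OF \<Lambda> prods, of "\<lambda>j. tgt A (q j)"] by auto
  note [simp] = is_productD(1)[OF PP] is_productD(1)[OF NN] is_productD(1)[OF LL]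
  have p [simp]: "p j \<in> arr A" "src A (p j) = PP" "tgt A (p j) = P" for j
    using is_productD(2)[OF PP, of j] by (auto simp: Hom_def)
  have n [simp]: "n j \<in> arr A" "src A (n j) = NN" "tgt A (n j) = N j" for j
    using is_productD(2)[OF NN, of j] by (auto simp: Hom_def)
  have s [simp]: "s j \<in> arr A" "src A (s j) = LL" "tgt A (s j) = tgt A (q j)" for j
    using is_productD(2)[OF LL, of j] by (auto simp: Hom_def)
  obtain D where D: "D \<in> Hom A PP NN" "\<And>j. n j \<cdot> D = d j \<cdot> p j"
    by (rule is_product_lift[OF NN, of PP "\<lambda>j. d j \<cdot> p j"]) (auto simp: Hom_def)
  obtain E where E: "E \<in> Hom A NN LL" "\<And>j. s j \<cdot> E = q j \<cdot> n j"
    by (rule is_product_lift[OF LL, of NN "\<lambda>j. q j \<cdot> n j"]) (auto simp: Hom_def)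
  obtain FN where FN: "FN \<in> Hom A NN NN" "\<And>j. n j \<cdot> FN = t j \<cdot> n (Suc j)"
    by (rule is_product_lift[OF NN, of NN "\<lambda>j. t j \<cdot> n (Suc j)"]) (auto simp: Hom_def)
  obtain FL where FL: "FL \<in> Hom A LL LL" "\<And>j. s j \<cdot> FL = l j \<cdot> s (Suc j)"
    by (rule is_product_lift[OF LL, of LL "\<lambda>j. l j \<cdot> s (Suc j)"]) (auto simp: Hom_def)
  have D' [simp]: "D \<in> arr A" "src A D = PP" "tgt A D = NN" using D by (auto simp: Hom_def)
  have E' [simp]: "E \<in> arr A" "src A E = NN" "tgt A E = LL" using E by (auto simp: Hom_def)
  have FN' [simp]: "FN \<in> arr A" "src A FN = NN" "tgt A FN = NN" using FN by (auto simp: Hom_def)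
  have FL' [simp]: "FL \<in> arr A" "src A FL = LL" "tgt A FL = LL" using FL by (auto simp: Hom_def)
  \<comment> \<open>Exactness of products enters here. Arrows out of the product \<open>LL\<close>
    can now be constructed as arrows out of \<open>NN\<close> that kill \<open>D\<close>, and they
    can be compared after composition with \<open>E\<close>.\<close>
  have E_coker: "is_cokernel A D E"
    by (rule product_of_cokernels[OF \<Lambda> ex d_Hom q_coker PP NN LL D E])
  note E_epi = cokernel_epi[OF E_coker]
  have EF: "E \<cdot> FN = FL \<cdot> E"
  proof (rule is_product_eqI[OF LL, of _ NN])
    show "E \<cdot> FN \<in> Hom A NN LL" "FL \<cdot> E \<in> Hom A NN LL" by (auto simp: Hom_def)
    fix j
    have "s j \<cdot> (E \<cdot> FN) = q j \<cdot> (t j \<cdot> n (Suc j))"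
      by (simp add: comp_assoc_arr[symmetric] E(2)) (simp add: comp_assoc_arr FN(2))
    also have "\<dots> = l j \<cdot> (s (Suc j) \<cdot> E)" by (simp add: E(2) l_q_comp)
    also have "\<dots> = s j \<cdot> (FL \<cdot> E)"
      using comp_assoc_arr[of E FL "s j"] comp_assoc_arr[of E "s (Suc j)" "l j"] by (simp add: FL(2))
    finally show "s j \<cdot> (E \<cdot> FN) = s j \<cdot> (FL \<cdot> E)" .
  qed
  \<comment> \<open>The universal case over N: the right-hand side is the family of projections of
    \<open>NN\<close> itself.\<close>
  obtain x where x: "\<And>j. x j \<in> Hom A NN (N j)" "\<And>j. x j = n j \<oplus> t j \<cdot> x (Suc j)"
    using N_solvable[of n NN] is_productD(2)[OF NN] by blast
  have x' [simp]: "x j \<in> arr A" "src A (x j) = NN" "tgt A (x j) = N j" for j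
    using x(1)[of j] by (auto simp: Hom_def)
  have nxt: "n j \<oplus> t j \<cdot> x (Suc j) = x j" for j using x(2)[of j] by simp
  obtain y where y: "\<And>j. y j \<in> Hom A PP P" "\<And>j. p j \<oplus> y (Suc j) = y j"
    by (rule telescope_exists[of p PP P]) (auto simp: Hom_def)
  have y' [simp]: "y j \<in> arr A" "src A (y j) = PP" "tgt A (y j) = P" for j
    using y(1)[of j] by (auto simp: Hom_def)
  \<comment> \<open>Both families solve the system with right-hand side d j p j: the first because x
    has right-hand side n and n j D = d j p j, the second because \<open>t_d\<close> carries the
    telescope \<open>y\<close> along \<open>d\<close>. They therefore agree after
    \<open>q j\<close>, and the second becomes zero there.\<close>
  have "q j \<cdot> (x j \<cdot> D) = q j \<cdot> (d j \<cdot> y j)" for j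
  proof (rule N_unique_modulo_d[where a = "\<lambda>j. d j \<cdot> p j" and W = PP
        and x = "\<lambda>j. x j \<cdot> D" and y = "\<lambda>j. d j \<cdot> y j"])
    show "x j \<cdot> D = d j \<cdot> p j \<oplus> t j \<cdot> (x (Suc j) \<cdot> D)" for j
      by (subst nxt[symmetric]) (simp add: add_comp comp_assoc_arr D(2))
    have "t j \<cdot> (d (Suc j) \<cdot> y (Suc j)) = d j \<cdot> y (Suc j)" for j
      using comp_assoc_arr[of "y (Suc j)" "d (Suc j)" "t j"] by (simp add: t_d)
    then show "d j \<cdot> y j = d j \<cdot> p j \<oplus> t j \<cdot> (d (Suc j) \<cdot> y (Suc j))" for j
      using comp_add[of "p j" "y (Suc j)" "d j"] by (simp add: y(2))
  qed (auto simp: Hom_def)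
  then have qxD: "(q j \<cdot> x j) \<cdot> D = hzero A PP (tgt A (q j))" for j
    using comp_assoc_arr[of "y j" "d j" "q j"] by (simp add: comp_assoc_arr q_d)
  have "\<exists>v. v \<in> Hom A LL (tgt A (q j)) \<and> v \<cdot> E = q j \<cdot> x j" for j
    by (rule is_cokernel_lift[OF E_coker, of "q j \<cdot> x j"]) (auto simp: qxD Hom_def)
  then obtain v where v: "\<And>j. v j \<in> Hom A LL (tgt A (q j))" "\<And>j. v j \<cdot> E = q j \<cdot> x j"
    by metis
  have v' [simp]: "v j \<in> arr A" "src A (v j) = LL" "tgt A (v j) = tgt A (q j)" for j
    using v(1)[of j] by (auto simp: Hom_def)
  have v_right: "s j \<oplus> l j \<cdot> v (Suc j) = v j" for j
  proof (rule is_epi_cancel[OF E_epi])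
    have "(s j \<oplus> l j \<cdot> v (Suc j)) \<cdot> E = q j \<cdot> n j \<oplus> q j \<cdot> (t j \<cdot> x (Suc j))"
      by (simp add: add_comp comp_assoc_arr E(2) v(2) l_q_comp)
    also have "\<dots> = v j \<cdot> E"
      using comp_add[of "n j" "t j \<cdot> x (Suc j)" "q j"] by (simp add: nxt v(2))
    finally show "(s j \<oplus> l j \<cdot> v (Suc j)) \<cdot> E = v j \<cdot> E" .
  qed auto
  \<comment> \<open>In components this is v (1 - FL) = 1, while \<open>v_right\<close> is (1 - FL) v
    = 1. It holds because n j + x j FN solves the same system as \<open>x\<close>, so
    \<open>N_unique_modulo_d\<close> identifies the two after \<open>q j\<close>.\<close>
  have v_left: "s j \<oplus> v j \<cdot> FL = v j" for j
  proof (rule is_epi_cancel[OF E_epi])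
    have "q j \<cdot> (n j \<oplus> x j \<cdot> FN) = q j \<cdot> x j"
    proof (rule N_unique_modulo_d[where a = n and W = NN and x = "\<lambda>j. n j \<oplus> x j \<cdot> FN" and y = x])
      show "n j \<oplus> x j \<cdot> FN = n j \<oplus> t j \<cdot> (n (Suc j) \<oplus> x (Suc j) \<cdot> FN)" for j
        by (subst nxt[of j, symmetric]) (simp add: add_comp comp_add comp_assoc_arr FN(2))
      show "x j = n j \<oplus> t j \<cdot> x (Suc j)" for j by (rule x(2))
    qed (auto simp: Hom_def)
    moreover have "(v j \<cdot> FL) \<cdot> E = q j \<cdot> (x j \<cdot> FN)"
      using comp_assoc_arr[of FN E "v j"] comp_assoc_arr[of E FL "v j"] comp_assoc_arr[of FN "x j" "q j"]
      by (simp add: EF v(2))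
    ultimately show "(s j \<oplus> v j \<cdot> FL) \<cdot> E = v j \<cdot> E"
      by (simp add: add_comp E(2) v(2) comp_add)
  qed auto
  show ?thesis unfolding uniquely_solvable_def fst_conv snd_conv
  proof (intro ballI allI impI)
    fix W a assume W: "W \<in> obj A" and a: "\<forall>j. a j \<in> Hom A W (tgt A (q j))"
    obtain b where b: "b \<in> Hom A W LL" "\<And>j. s j \<cdot> b = a j"
      by (rule is_product_lift[OF LL W, of a]) (use a in blast)+
    have b' [simp]: "b \<in> arr A" "src A b = W" "tgt A b = LL" using b(1) by (auto simp: Hom_def)
    show "\<exists>!z. \<forall>j. z j \<in> Hom A W (tgt A (q j)) \<and> z j = a j \<oplus> l j \<cdot> z (Suc j)"
    proof (rule ex1I[of _ "\<lambda>j. v j \<cdot> b"])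
      have "v j \<cdot> b = a j \<oplus> l j \<cdot> (v (Suc j) \<cdot> b)" for j
        by (subst v_right[symmetric]) (simp add: add_comp comp_assoc_arr b(2))
      then show "\<forall>j. v j \<cdot> b \<in> Hom A W (tgt A (q j)) \<and> v j \<cdot> b = a j \<oplus> l j \<cdot> (v (Suc j) \<cdot> b)"
        using comp_Hom[OF b(1) v(1)] by blast
      fix z assume z: "\<forall>j. z j \<in> Hom A W (tgt A (q j)) \<and> z j = a j \<oplus> l j \<cdot> z (Suc j)"
      obtain c where c: "c \<in> Hom A W LL" "\<And>j. s j \<cdot> c = z j"
        by (rule is_product_lift[OF LL W, of z]) (use z in blast)+
      have c' [simp]: "c \<in> arr A" "src A c = W" "tgt A c = LL" using c(1) by (auto simp: Hom_def)
      have "b \<oplus> FL \<cdot> c = c"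
      proof (rule is_product_eqI[OF LL _ c(1)])
        fix j
        have "s j \<cdot> (b \<oplus> FL \<cdot> c) = a j \<oplus> l j \<cdot> z (Suc j)"
          using comp_assoc_arr[of c FL "s j"] comp_assoc_arr[of c "s (Suc j)" "l j"]
          by (simp add: comp_add b(2) FL(2) c(2))
        also have "\<dots> = z j" using z by metis
        finally show "s j \<cdot> (b \<oplus> FL \<cdot> c) = s j \<cdot> c" by (simp only: c(2))
      qed (simp add: Hom_def)
      have "z j = v j \<cdot> b" for j
      proof -
        \<comment> \<open>Since z j = s j c, this is \<open>v_left\<close> composed with
          \<open>c\<close>. Expanding c = b + FL c on the right and cancelling leaves z j = v j
          b.\<close>
        have "v j \<cdot> (FL \<cdot> c) \<oplus> z j = v j \<cdot> c"
          by (subst v_left[symmetric])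
            (simp add: add_comp comp_assoc_arr c(2)[symmetric] add_commute[of "v j \<cdot> (FL \<cdot> c)"])
        also have "\<dots> = v j \<cdot> (FL \<cdot> c) \<oplus> v j \<cdot> b"
          using comp_add[of b "FL \<cdot> c" "v j"]
          by (simp add: \<open>b \<oplus> FL \<cdot> c = c\<close> add_commute[of "v j \<cdot> b"])
        finally show ?thesis
          by (subst (asm) add_left_cancel) (simp_all add: c(2)[symmetric])
      qed
      then show "z = (\<lambda>j. v j \<cdot> b)" by auto
    qed
  qed
qed

section \<open>The universal property\<close>

lemma inclusion_exists:
  obtains i k where "\<And>j. i j \<in> Hom A P (N j)" "\<And>j. \<pi> j \<cdot> i j = ident A P"
    "\<And>j. \<rho> j \<cdot> i j = hzero A P (S j)"
    "\<And>j. k j \<in> Hom A (S j) (N j)" "\<And>j. \<pi> j \<cdot> k j = hzero A (S j) P"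
    "\<And>j. \<rho> j \<cdot> k j = ident A (S j)"
proof -
  have "\<exists>x. x \<in> Hom A P (N j) \<and> \<pi> j \<cdot> x = ident A P \<and> \<rho> j \<cdot> x = hzero A P (S j)" for j
    by (rule N_pair[of "ident A P" P "hzero A P (S j)" j]) (auto simp: Hom_def)
  moreover have "\<exists>x. x \<in> Hom A (S j) (N j) \<and> \<pi> j \<cdot> x = hzero A (S j) P \<and> \<rho> j \<cdot> x = ident A (S j)"
    for j
    by (rule N_pair[of "hzero A (S j) P" "S j" "ident A (S j)" j]) (auto simp: Hom_def)
  ultimately show ?thesis using that by metis
qed

text \<open>A morphism from L to T amounts to a morphism N -> T that kills \<open>d\<close>. On the
  summand \<open>S j\<close> it has to be the given \<phi> j. Compatibility with \<open>t\<close>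
  turns its restriction \<open>u\<close> to the summand \<open>P\<close> into the solution of a
  linear system over T, so unique solvability yields both existence and uniqueness.\<close>

lemma L_universal:
  obtains \<eta> where "\<eta> \<in> Hom (invseq_cat A) (S, f) L"
    "\<And>T g. is_invseq A T \<Longrightarrow> uniquely_solvable A T \<Longrightarrow> g \<in> Hom (invseq_cat A) (S, f) T \<Longrightarrow>
      \<exists>!h. h \<in> Hom (invseq_cat A) L T \<and> h \<cdot>\<^bsub>invseq_cat A\<^esub> \<eta> = g"
proof -
  obtain i k where i: "\<And>j. i j \<in> Hom A P (N j)" "\<And>j. \<pi> j \<cdot> i j = ident A P"
    "\<And>j. \<rho> j \<cdot> i j = hzero A P (S j)"
    and k: "\<And>j. k j \<in> Hom A (S j) (N j)" "\<And>j. \<pi> j \<cdot> k j = hzero A (S j) P"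
    "\<And>j. \<rho> j \<cdot> k j = ident A (S j)"
    using inclusion_exists by metis
  have i' [simp]: "i j \<in> arr A" "src A (i j) = P" "tgt A (i j) = N j" for j
    using i(1)[of j] by (auto simp: Hom_def)
  have k' [simp]: "k j \<in> arr A" "src A (k j) = S j" "tgt A (k j) = N j" for j
    using k(1)[of j] by (auto simp: Hom_def)
  have tk: "t j \<cdot> k (Suc j) = k j \<cdot> f j" for j
    using N_eqI[of "t j \<cdot> k (Suc j)" "S (Suc j)" j "k j \<cdot> f j"]
      comp_assoc_arr[symmetric, of "f j" "k j" "\<pi> j"] comp_assoc_arr[symmetric, of "f j" "k j" "\<rho> j"]
    by (simp add: Hom_def t_components k)
  \<comment> \<open>By \<open>tk\<close> the injections \<open>k\<close> form a morphism S -> N, but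
    the injections \<open>i\<close> of \<open>P\<close> are not compatible with \<open>t\<close>.
    Their defect k j pr j is the source of the inhomogeneous term in the system for
    \<open>u\<close>.\<close>
  have ti: "t j \<cdot> i (Suc j) = i j \<oplus> k j \<cdot> pr j" for j
    using N_eqI[of "t j \<cdot> i (Suc j)" P j "i j \<oplus> k j \<cdot> pr j"]
      comp_assoc_arr[symmetric, of "pr j" "k j" "\<pi> j"] comp_assoc_arr[symmetric, of "pr j" "k j" "\<rho> j"]
    by (simp add: Hom_def t_components i k comp_add)
  have split: "i j \<cdot> \<pi> j \<oplus> k j \<cdot> \<rho> j = ident A (N j)" for j
    using N_eqI[of "i j \<cdot> \<pi> j \<oplus> k j \<cdot> \<rho> j" "N j" j "ident A (N j)"]
      comp_assoc_arr[symmetric, of "\<pi> j" "i j" "\<pi> j"] comp_assoc_arr[symmetric, of "\<pi> j" "i j" "\<rho> j"]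
      comp_assoc_arr[symmetric, of "\<rho> j" "k j" "\<pi> j"] comp_assoc_arr[symmetric, of "\<rho> j" "k j" "\<rho> j"]
    by (simp add: Hom_def i k comp_add)
  have invS: "is_invseq A (S, f)" by (simp add: is_invseq_def Hom_def)
  let ?\<eta> = "((S, f), L, \<lambda>j. q j \<cdot> k j)"
  have "?\<eta> \<in> Hom (invseq_cat A) (S, f) L"
    unfolding invseq_Hom_iff using invS invseq_L
    by (auto simp: Hom_def l_q_comp tk comp_assoc_arr)
  moreover have "\<exists>!h. h \<in> Hom (invseq_cat A) L T \<and> h \<cdot>\<^bsub>invseq_cat A\<^esub> ?\<eta> = g"
    if T: "is_invseq A T" and sol: "uniquely_solvable A T" and g: "g \<in> Hom (invseq_cat A) (S, f) T"
    for T g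
  proof -
    obtain \<phi> where g_eq: "g = ((S, f), T, \<phi>)" and \<phi>: "\<And>j. \<phi> j \<in> Hom A (S j) (fst T j)"
      "\<And>j. snd T j \<cdot> \<phi> (Suc j) = \<phi> j \<cdot> f j"
      using g unfolding invseq_Hom_iff by auto
    have \<phi>' [simp]: "\<phi> j \<in> arr A" "src A (\<phi> j) = S j" "tgt A (\<phi> j) = fst T j" for j
      using \<phi>(1)[of j] by (auto simp: Hom_def)
    have T' [simp]: "fst T j \<in> obj A" "snd T j \<in> arr A" "src A (snd T j) = fst T (Suc j)"
      "tgt A (snd T j) = fst T j" for j
      using T by (auto simp: is_invseq_def Hom_def)
    \<comment> \<open>With this right-hand side the system says that u j + \<phi> j pr j equals
      \<open>snd T j\<close> applied to u (j+1), which is the image of \<open>ti\<close> under a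
      morphism N -> T extending \<phi>.\<close>
    have a: "neg (\<phi> j \<cdot> pr j) \<in> Hom A P (fst T j)" for j by (simp add: Hom_def)
    have eq_iff: "u j = neg (\<phi> j \<cdot> pr j) \<oplus> snd T j \<cdot> u (Suc j) \<longleftrightarrow>
        u j \<oplus> \<phi> j \<cdot> pr j = snd T j \<cdot> u (Suc j)"
      if u: "\<And>j. u j \<in> Hom A P (fst T j)" for u j
    proof -
      have u': "u j \<in> arr A" "src A (u j) = P" "tgt A (u j) = fst T j" for j
        using u[of j] by (auto simp: Hom_def)
      show ?thesis
      proof
        assume "u j = neg (\<phi> j \<cdot> pr j) \<oplus> snd T j \<cdot> u (Suc j)"
        then have "\<phi> j \<cdot> pr j \<oplus> u j = snd T j \<cdot> u (Suc j)"
          using u' add_neg_left(1)[of "\<phi> j \<cdot> pr j" "snd T j \<cdot> u (Suc j)"] by simp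
        then show "u j \<oplus> \<phi> j \<cdot> pr j = snd T j \<cdot> u (Suc j)"
          using u' by (simp add: add_commute[of "u j"])
      next
        assume "u j \<oplus> \<phi> j \<cdot> pr j = snd T j \<cdot> u (Suc j)"
        then have "snd T j \<cdot> u (Suc j) = \<phi> j \<cdot> pr j \<oplus> u j"
          using u' by (simp add: add_commute[of "u j"])
        then show "u j = neg (\<phi> j \<cdot> pr j) \<oplus> snd T j \<cdot> u (Suc j)"
          using u' by simp
      qed
    qed
    obtain u where u: "\<And>j. u j \<in> Hom A P (fst T j)"
      "\<And>j. u j = neg (\<phi> j \<cdot> pr j) \<oplus> snd T j \<cdot> u (Suc j)"
      using uniquely_solvable_obtain[OF sol P_obj a] by blast
    have u_eq: "snd T j \<cdot> u (Suc j) = u j \<oplus> \<phi> j \<cdot> pr j" for j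
      using eq_iff[OF u(1), THEN iffD1, OF u(2)] by metis
    have u' [simp]: "u j \<in> arr A" "src A (u j) = P" "tgt A (u j) = fst T j" for j
      using u(1)[of j] by (auto simp: Hom_def)
    define h' where "h' j = u j \<cdot> \<pi> j \<oplus> \<phi> j \<cdot> \<rho> j" for j
    have h' [simp]: "h' j \<in> arr A" "src A (h' j) = N j" "tgt A (h' j) = fst T j" for j
      by (simp_all add: h'_def)
    have h't: "snd T j \<cdot> h' (Suc j) = h' j \<cdot> t j" for j
    proof -
      have "snd T j \<cdot> h' (Suc j) =
          (u j \<oplus> \<phi> j \<cdot> pr j) \<cdot> \<pi> (Suc j) \<oplus> (\<phi> j \<cdot> f j) \<cdot> \<rho> (Suc j)"
        using comp_assoc_arr[of "\<pi> (Suc j)" "u (Suc j)" "snd T j"]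
          comp_assoc_arr[of "\<rho> (Suc j)" "\<phi> (Suc j)" "snd T j"]
        by (simp add: h'_def comp_add u_eq \<phi>(2))
      also have "\<dots> = h' j \<cdot> t j"
        by (simp add: h'_def add_comp comp_add comp_assoc_arr \<pi>_t \<rho>_t add_assoc
            add_commute[of "\<phi> j \<cdot> pr j \<cdot> \<pi> (Suc j)"])
      finally show ?thesis .
    qed
    \<comment> \<open>No computation with \<Delta> is required: \<open>d\<close> and
      \<open>h'\<close> are both compatible with the transition maps, so h' j d j solves the
      homogeneous system over T and must vanish.\<close>
    have h'd: "h' j \<cdot> d j = hzero A P (fst T j)" for j
    proof -
      have "(\<lambda>j. h' j \<cdot> d j) = (\<lambda>j. hzero A P (fst T j))"
      proof (rule uniquely_solvable_unique[OF sol P_obj, of "\<lambda>j. hzero A P (fst T j)"])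
        show "h' j \<cdot> d j = hzero A P (fst T j) \<oplus> snd T j \<cdot> (h' (Suc j) \<cdot> d (Suc j))" for j
          using comp_assoc_arr[of "d (Suc j)" "h' (Suc j)" "snd T j"]
            comp_assoc_arr[of "d (Suc j)" "t j" "h' j"] by (simp add: h't t_d)
      qed (auto simp: Hom_def)
      then show ?thesis by metis
    qed
    have "\<exists>h. h \<in> Hom A (tgt A (q j)) (fst T j) \<and> h \<cdot> q j = h' j" for j
      by (rule is_cokernel_lift[OF q_coker[of j], of "h' j"]) (auto simp: h'd Hom_def)
    then obtain h where h: "\<And>j. h j \<in> Hom A (tgt A (q j)) (fst T j)" "\<And>j. h j \<cdot> q j = h' j"
      by metis
    have h'' [simp]: "h j \<in> arr A" "src A (h j) = tgt A (q j)" "tgt A (h j) = fst T j" for j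
      using h(1)[of j] by (auto simp: Hom_def)
    have hl: "snd T j \<cdot> h (Suc j) = h j \<cdot> l j" for j
    proof (rule is_epi_cancel[OF q_epi[of "Suc j"]])
      show "(snd T j \<cdot> h (Suc j)) \<cdot> q (Suc j) = (h j \<cdot> l j) \<cdot> q (Suc j)"
        using comp_assoc_arr[of "t j" "q j" "h j"] by (simp add: comp_assoc_arr h(2) h't l_q)
    qed auto
    have h\<eta>: "h j \<cdot> (q j \<cdot> k j) = \<phi> j" for j
      using comp_assoc_arr[of "k j" "q j" "h j"]
      by (simp add: h(2)) (simp add: h'_def add_comp comp_assoc_arr k)
    show ?thesis
    proof (rule ex1I[of _ "(L, T, h)"])
      show "(L, T, h) \<in> Hom (invseq_cat A) L T \<and> (L, T, h) \<cdot>\<^bsub>invseq_cat A\<^esub> ?\<eta> = g"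
        using invseq_L T h(1) hl by (simp add: invseq_Hom_iff invseq_comp g_eq h\<eta>)
      fix m assume m: "m \<in> Hom (invseq_cat A) L T \<and> m \<cdot>\<^bsub>invseq_cat A\<^esub> ?\<eta> = g"
      then obtain c where m_eq: "m = (L, T, c)" and c: "\<And>j. c j \<in> Hom A (tgt A (q j)) (fst T j)"
        "\<And>j. snd T j \<cdot> c (Suc j) = c j \<cdot> l j"
        unfolding invseq_Hom_iff by auto
      have c' [simp]: "c j \<in> arr A" "src A (c j) = tgt A (q j)" "tgt A (c j) = fst T j" for j
        using c(1)[of j] by (auto simp: Hom_def)
      have "(\<lambda>j. c j \<cdot> (q j \<cdot> k j)) = \<phi>" using m by (simp add: m_eq invseq_comp g_eq)
      then have c\<eta>: "c j \<cdot> (q j \<cdot> k j) = \<phi> j" for j by metis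
      \<comment> \<open>Stated for an arbitrary factorization \<open>b\<close> of \<phi>, since it
        is applied both to the competitor \<open>c\<close> and to the constructed \<open>h\<close>:
        their restrictions to \<open>P\<close> solve the same system.\<close>
      have c_i: "b j \<cdot> (q j \<cdot> i j) = neg (\<phi> j \<cdot> pr j) \<oplus> snd T j \<cdot> (b (Suc j) \<cdot> (q (Suc j) \<cdot> i (Suc j)))"
        if b: "\<And>j. b j \<in> arr A" "\<And>j. src A (b j) = tgt A (q j)" "\<And>j. tgt A (b j) = fst T j"
          "\<And>j. snd T j \<cdot> b (Suc j) = b j \<cdot> l j" "\<And>j. b j \<cdot> (q j \<cdot> k j) = \<phi> j" for b j
      proof -
        have "snd T j \<cdot> (b (Suc j) \<cdot> (q (Suc j) \<cdot> i (Suc j))) = b j \<cdot> (q j \<cdot> (t j \<cdot> i (Suc j)))"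
          using b(1-3) comp_assoc_arr[of "q (Suc j) \<cdot> i (Suc j)" "b (Suc j)" "snd T j"]
          by (simp add: b(4) comp_assoc_arr l_q_comp)
        also have "\<dots> = b j \<cdot> (q j \<cdot> i j) \<oplus> (b j \<cdot> (q j \<cdot> k j)) \<cdot> pr j"
          using b(1-3) by (simp add: ti comp_add comp_assoc_arr)
        finally have "b j \<cdot> (q j \<cdot> i j) \<oplus> \<phi> j \<cdot> pr j =
            snd T j \<cdot> (b (Suc j) \<cdot> (q (Suc j) \<cdot> i (Suc j)))"
          by (simp add: b(5))
        then show ?thesis
          using b(1-3) by (subst eq_iff[of "\<lambda>j. b j \<cdot> (q j \<cdot> i j)"]) (auto simp: Hom_def)
      qed
      have "(\<lambda>j. c j \<cdot> (q j \<cdot> i j)) = (\<lambda>j. h j \<cdot> (q j \<cdot> i j))"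
        by (rule uniquely_solvable_unique[OF sol P_obj a])
          (auto simp: Hom_def intro!: c_i c(2) c\<eta> hl h\<eta>)
      then have ci: "c j \<cdot> (q j \<cdot> i j) = h j \<cdot> (q j \<cdot> i j)" for j by metis
      \<comment> \<open>An arrow on \<open>N j\<close> is determined by its restrictions to the two
        summands, and \<open>q j\<close> is epi; so agreement on \<open>P\<close> and on
        \<open>S j\<close> forces c j = h j.\<close>
      have via: "b \<cdot> q j = (b \<cdot> (q j \<cdot> i j)) \<cdot> \<pi> j \<oplus> (b \<cdot> (q j \<cdot> k j)) \<cdot> \<rho> j"
        if "b \<in> arr A" "src A b = tgt A (q j)" for b j
      proof -
        have "b \<cdot> q j = (b \<cdot> q j) \<cdot> (i j \<cdot> \<pi> j \<oplus> k j \<cdot> \<rho> j)"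
          unfolding split using that by simp
        then show ?thesis using that by (simp add: comp_add comp_assoc_arr)
      qed
      have "c j = h j" for j
        by (rule is_epi_cancel[OF q_epi[of j]]) (simp_all add: via ci c\<eta> h\<eta>)
      then show "m = (L, T, h)" using m_eq by auto
    qed
  qed
  ultimately show ?thesis by (rule that)
qed

end

section \<open>Assembling the localization of a given sequence\<close>

lemma (in abelian_category) local_reflection:
  fixes \<Lambda> :: "'u rel"
  assumes \<Lambda>: "inaccessible_cardinal \<Lambda>" and ex: "has_exact_small_products \<Lambda> A"
    and X: "is_invseq A X"
  shows "\<exists>L \<eta>. is_local A L \<and> \<eta> \<in> Hom (invseq_cat A) X L \<and>
    (\<forall>T. is_local A T \<longrightarrow> (\<forall>g \<in> Hom (invseq_cat A) X T.
      \<exists>!h. h \<in> Hom (invseq_cat A) L T \<and> h \<cdot>\<^bsub>invseq_cat A\<^esub> \<eta> = g))"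
proof -
  have prods: "has_small_products \<Lambda> A" using ex by (simp add: has_exact_small_products_def)
  obtain S f where Sf: "X = (S, f)" by (cases X)
  have S: "S j \<in> obj A" and f: "f j \<in> Hom A (S (Suc j)) (S j)" for j
    using X by (auto simp: is_invseq_def Sf)
  have f' [simp]: "f j \<in> arr A" "src A (f j) = S (Suc j)" "tgt A (f j) = S j" for j
    using f[of j] by (auto simp: Hom_def)
  obtain P pr where P: "is_product A UNIV S P pr"
    using countable_product_exists[OF \<Lambda> prods, of S] S by auto
  have [simp]: "P \<in> obj A" "pr j \<in> arr A" "src A (pr j) = P" "tgt A (pr j) = S j" for j
    using is_productD(1)[OF P] is_productD(2)[OF P, of j] by (auto simp: Hom_def)
  \<comment> \<open>The arrow 1 - F is defined directly by its components, so F itself does not have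
    to be constructed.\<close>
  obtain \<Delta> where \<Delta>: "\<Delta> \<in> Hom A P P" "\<And>j. pr j \<cdot> \<Delta> = pr j \<oplus> neg (f j \<cdot> pr (Suc j))"
    by (rule is_product_lift[OF P, of P "\<lambda>j. pr j \<oplus> neg (f j \<cdot> pr (Suc j))"]) (auto simp: Hom_def)
  have pr\<Delta>: "pr j \<cdot> \<Delta> \<oplus> f j \<cdot> pr (Suc j) = pr j" for j
    by (simp add: \<Delta>(2) add_assoc)
  have "\<forall>j. \<exists>N p. is_product A UNIV (\<lambda>b. if b then P else S j) N p"
    using binary_products S by simp
  then obtain N p where Np: "\<And>j. is_product A UNIV (\<lambda>b. if b then P else S j) (N j) (p j)" by metis
  define \<pi> \<rho> where "\<pi> j = p j True" and "\<rho> j = p j False" for j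
  have "p j = (\<lambda>b. if b then \<pi> j else \<rho> j)" for j by (auto simp: \<pi>_def \<rho>_def)
  then have N: "is_product A UNIV (\<lambda>b. if b then P else S j) (N j) (\<lambda>b. if b then \<pi> j else \<rho> j)" for j
    using Np by metis
  have \<pi>: "\<pi> j \<in> Hom A (N j) P" and \<rho>: "\<rho> j \<in> Hom A (N j) (S j)" for j
    using is_productD(2)[OF Np, of True j] is_productD(2)[OF Np, of False j]
    by (auto simp: \<pi>_def \<rho>_def)
  \<comment> \<open>Pairing is needed before the locale can be interpreted, because \<open>d\<close>
    and \<open>t\<close> are themselves obtained by pairing.\<close>
  have pair: "\<exists>x. x \<in> Hom A W (N j) \<and> \<pi> j \<cdot> x = y \<and> \<rho> j \<cdot> x = s"
    if ys: "y \<in> Hom A W P" "s \<in> Hom A W (S j)" for W j y s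
  proof -
    have W: "W \<in> obj A" using Hom_obj(1)[OF ys(1)] .
    obtain x where "x \<in> Hom A W (N j)" "\<And>b. p j b \<cdot> x = (if b then y else s)"
      by (rule is_product_lift[OF Np[of j] W, of "\<lambda>b. if b then y else s"])
        (use ys in auto)
    then show ?thesis by (auto simp: \<pi>_def \<rho>_def)
  qed
  have "\<exists>x. x \<in> Hom A P (N j) \<and> \<pi> j \<cdot> x = \<Delta> \<and> \<rho> j \<cdot> x = pr j" for j
    by (rule pair[OF \<Delta>(1)]) (simp add: Hom_def)
  then obtain d where d: "\<And>j. d j \<in> Hom A P (N j)" "\<And>j. \<pi> j \<cdot> d j = \<Delta>" "\<And>j. \<rho> j \<cdot> d j = pr j"
    by metis
  have "\<exists>x. x \<in> Hom A (N (Suc j)) (N j) \<and> \<pi> j \<cdot> x = \<pi> (Suc j) \<and>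
      \<rho> j \<cdot> x = f j \<cdot> \<rho> (Suc j) \<oplus> pr j \<cdot> \<pi> (Suc j)" for j
    by (rule pair[OF \<pi>]) (use \<pi>[of "Suc j"] \<rho>[of "Suc j"] in \<open>auto simp: Hom_def\<close>)
  then obtain t where t: "\<And>j. t j \<in> Hom A (N (Suc j)) (N j)" "\<And>j. \<pi> j \<cdot> t j = \<pi> (Suc j)"
    "\<And>j. \<rho> j \<cdot> t j = f j \<cdot> \<rho> (Suc j) \<oplus> pr j \<cdot> \<pi> (Suc j)" by metis
  have "\<forall>j. \<exists>q. is_cokernel A (d j) q" using cokernels d(1) by (auto simp: Hom_def)
  then obtain q where q: "\<And>j. is_cokernel A (d j) (q j)" by metis
  interpret localization_data A S f P pr \<Delta> N \<pi> \<rho> d t q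
    by unfold_locales (fact f P \<Delta>(1) pr\<Delta> N d t q)+
  obtain l where l: "\<And>j. l j \<in> Hom A (tgt A (q (Suc j))) (tgt A (q j))"
    "\<And>j. l j \<cdot> q (Suc j) = q j \<cdot> t j"
    using transition_exists by blast
  interpret localization A S f P pr \<Delta> N \<pi> \<rho> d t q l
    by unfold_locales (fact l)+
  \<comment> \<open>\<open>is_local\<close> asks for an actual shift on a product of the terms, so
    such a product has to be exhibited.\<close>
  obtain R s where R: "is_product A UNIV (fst L) R s"
    using countable_product_exists[OF \<Lambda> prods, of "fst L"] by auto
  obtain Z where Z: "is_zero_object A Z" using zero_object by blast
  have "is_local A L"
    by (rule local_if_uniquely_solvable[OF invseq_L R Z L_uniquely_solvable[OF \<Lambda> ex]])
  moreover obtain \<eta> where "\<eta> \<in> Hom (invseq_cat A) (S, f) L"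
    "\<And>T g. is_invseq A T \<Longrightarrow> uniquely_solvable A T \<Longrightarrow> g \<in> Hom (invseq_cat A) (S, f) T \<Longrightarrow>
      \<exists>!h. h \<in> Hom (invseq_cat A) L T \<and> h \<cdot>\<^bsub>invseq_cat A\<^esub> \<eta> = g"
    using L_universal by blast
  moreover have "is_invseq A T \<and> uniquely_solvable A T" if "is_local A T" for T
    using that uniquely_solvable_if_local by (auto simp: is_local_def)
  ultimately show ?thesis unfolding Sf by blast
qed

theorem proposition2p5:
  fixes \<Lambda> \<kappa> :: "'u rel"
    and A :: "('o, 'm) preadd_cat"
    and G :: 'o
  assumes "inaccessible_cardinal \<Lambda>"
    and "abelian_category A"
    and "locally_small \<Lambda> A"
    and "has_small_coproducts \<Lambda> A"
    and "has_exact_small_products \<Lambda> A"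
    and "regular_cardinal \<kappa>" and "\<kappa> <o \<Lambda>"
    and "is_generator A G"
    and "is_compact \<Lambda> \<kappa> A G"
  shows "(\<forall>S. is_invseq A S \<longrightarrow>
           (\<exists>L \<eta>. is_local A L \<and> \<eta> \<in> Hom (invseq_cat A) S L \<and>
              (\<forall>T. is_local A T \<longrightarrow> (\<forall>g \<in> Hom (invseq_cat A) S T.
                 \<exists>!h. h \<in> Hom (invseq_cat A) L T \<and> h \<cdot>\<^bsub>invseq_cat A\<^esub> \<eta> = g)))) \<and>
         reflective (invseq_cat A) (is_local A)"
proof -
  interpret abelian_category A by fact
  interpret seq: category "invseq_cat A" by (rule invseq_category)
  note refl = local_reflection[OF \<open>inaccessible_cardinal \<Lambda>\<close> \<open>has_exact_small_products \<Lambda> A\<close>]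
  have "reflective (invseq_cat A) (is_local A)"
  proof (rule seq.reflective_if_universal_arrows)
    fix X assume "X \<in> obj (invseq_cat A)"
    then obtain L \<eta> where L: "is_local A L" "\<eta> \<in> Hom (invseq_cat A) X L"
      "\<forall>T. is_local A T \<longrightarrow> (\<forall>g \<in> Hom (invseq_cat A) X T.
        \<exists>!h. h \<in> Hom (invseq_cat A) L T \<and> h \<cdot>\<^bsub>invseq_cat A\<^esub> \<eta> = g)"
      using refl[of X] by (auto simp: invseq_obj)
    moreover have "L \<in> obj (invseq_cat A)" using L(1) by (simp add: is_local_def invseq_obj)
    ultimately show "\<exists>L \<eta>. L \<in> obj (invseq_cat A) \<and> is_local A L \<and> \<eta> \<in> Hom (invseq_cat A) X L \<and>
        (\<forall>Y\<in>obj (invseq_cat A). is_local A Y \<longrightarrow> (\<forall>g\<in>Hom (invseq_cat A) X Y.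
          \<exists>!h. h \<in> Hom (invseq_cat A) L Y \<and> h \<cdot>\<^bsub>invseq_cat A\<^esub> \<eta> = g))"
      by blast
  qed
  with refl show ?thesis by blast
qed

end
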